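(* Let $f(z)=\sum_{k=1}^{\infty}a_kz^k+\overline{\sum_{k=1}^{\infty}b_kz^k}$ belong to $\mathcal{S}_H$. Let $R_f$ denote the radius of convergence of $f$ and $R_n$ the radius of univalence of $f^{(n)}$. Let $\alpha=\sup\{|a_2|: f\in\mathcal{S}_H\}$ and $\beta=\sup\{|b_2|: f\in\mathcal{S}_H\}$. (i) $$\liminf_{n\to\infty}nR_n\le 2(\alpha+\beta)R_f.$$ (ii) If $\limsup_{n\to\infty}\left|\frac{b_n}{a_n}\right|=\delta<1$ or $\limsup_{n\to\infty}\left|\frac{a_n}{b_n}\right|=\delta<1$, then $$\frac{1-\delta}{1+\delta}R_f\log 2\le\limsup_{n\to\infty}nR_n.$$ (iii) If there is a nonnegative integer $N$ such that $R_n>0$ for all $n\ge N$, then $$\liminf_{n\to\infty}\left[n(R_NR_{N+1}\cdots R_n)^{1/n}\right]\le 2\max\{\alpha,\beta\}\,e\,R_f.$$ (iv) If $\limsup_{n\to\infty}\left|\frac{b_n}{a_n}\right|=\delta<1$ or $\limsup_{n\to\infty}\left|\frac{a_n}{b_n}\right|=\delta<1$, and there is a positive integer $N$ such that $\{A_{n-1}\}_{n=N}^{\infty}$, with $A_{n-1}=\frac{|a_{n-1}|+|b_{n-1}|}{|a_n|+|b_n|}$, is a positive and nondecreasing sequence, then $$\frac{1-\delta}{1+\delta}R_f\log 2\le\liminf_{n\to\infty}nR_n\le\limsup_{n\to\infty}nR_n\le 2(\alpha+\beta)R_f.$$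
   Context: Let $\mathbb{D}=\{z\in\mathbb{C}:|z|<1\}$. A harmonic mapping $f=h+\overline{g}$ ($h,g$ analytic) is sense-preserving if $g'=\omega h'$ for some analytic $\omega$ with $|\omega|<1$ and $f$ is nonconstant. $\mathcal{S}_H$ is the class of all univalent (injective) sense-preserving harmonic mappings $f=h+\overline{g}$ in $\mathbb{D}$ with $h(z)=\sum_{n=1}^{\infty}a_nz^n$, $a_1=1$, and $g(z)=\sum_{n=1}^{\infty}b_nz^n$. In the definitions of $\alpha,\beta$ (which are finite), $a_2$ and $b_2$ are the second coefficients of $h$ and $g$. $R_f=\min\{R_h,R_g\}\in(0,\infty]$, where $R_h,R_g$ are the radii of convergence of the power series of $h$ and $g$ about $0$. For $n\ge0$, $f^{(n)}:=h^{(n)}+\overline{g^{(n)}}$, and $R_n\in[0,\infty]$ is the largest number such that $f^{(n)}$ is univalent in $|z|<R_n$ (with $R_n=0$ if $f^{(n)}$ is not univalent in any disk centred at $0$). The hypotheses on $\limsup|b_n/a_n|$ (resp. $\limsup|a_n/b_n|$) presuppose that the quotients are defined, i.e. the denominators are nonzero, for all large $n$; likewise the $A_{n-1}$, $n\ge N$, are presupposed to be defined. *)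

theory Defs
  imports "HOL-Complex_Analysis.Complex_Analysis"
begin

definition sense_preserving_harmonic_on ::
    "complex set \<Rightarrow> (complex \<Rightarrow> complex) \<Rightarrow> (complex \<Rightarrow> complex) \<Rightarrow> bool" where
  "sense_preserving_harmonic_on S h g \<longleftrightarrow>
     h holomorphic_on S \<and> g holomorphic_on S \<and>
     \<not> (\<lambda>z. h z + cnj (g z)) constant_on S \<and>
     (\<exists>\<omega>. \<omega> holomorphic_on S \<and>
          (\<forall>z\<in>S. cmod (\<omega> z) < 1 \<and> deriv g z = \<omega> z * deriv h z))"

(* h and g vanish at 0, so f = h + cnj g determines both of them.  The mapping f is therefore
   represented by the pair (h, g) of Taylor series at 0.  The two conditions on the radii of
   convergence cannot be left to holomorphic_on, as eval_fps is a junk value where the series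
   diverges. *)
definition S_H :: "(complex fps \<times> complex fps) set" where
  "S_H = {(h, g).
     fps_conv_radius h \<ge> 1 \<and> fps_conv_radius g \<ge> 1 \<and>
     fps_nth h 0 = 0 \<and> fps_nth h 1 = 1 \<and> fps_nth g 0 = 0 \<and>
     sense_preserving_harmonic_on (ball 0 1) (eval_fps h) (eval_fps g) \<and>
     inj_on (\<lambda>z. eval_fps h z + cnj (eval_fps g z)) (ball 0 1)}"

(* Suprema and radii are taken in the extended reals, where Sup needs no boundedness proviso. *)
definition alpha_H :: ereal where
  "alpha_H = (SUP (h, g)\<in>S_H. ereal (cmod (fps_nth h 2)))"

definition beta_H :: ereal where
  "beta_H = (SUP (h, g)\<in>S_H. ereal (cmod (fps_nth g 2)))"

definition harm_conv_radius :: "complex fps \<Rightarrow> complex fps \<Rightarrow> ereal" where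
  "harm_conv_radius h g = min (fps_conv_radius h) (fps_conv_radius g)"

definition harm_deriv :: "nat \<Rightarrow> complex fps \<Rightarrow> complex fps \<Rightarrow> complex \<Rightarrow> complex" where
  "harm_deriv n h g z = (deriv ^^ n) (eval_fps h) z + cnj ((deriv ^^ n) (eval_fps g) z)"

(* The n-th derivative lives on the common disc of convergence of h and g, which may be larger
   than the unit disc.  The supremum is attained, since the discs are nested; r = 0 always
   qualifies, so the value is 0 if there is no disc of univalence. *)
definition univalence_radius :: "nat \<Rightarrow> complex fps \<Rightarrow> complex fps \<Rightarrow> ereal" where
  "univalence_radius n h g =
     Sup {r. 0 \<le> r \<and> r \<le> harm_conv_radius h g \<and> inj_on (harm_deriv n h g) (eball 0 r)}"

definition ereal_root :: "nat \<Rightarrow> ereal \<Rightarrow> ereal" where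
  "ereal_root n x = (if x = \<infinity> then \<infinity> else ereal (root n (real_of_ereal x)))"

(* limsup |b_n / a_n| = d, including that the quotients are defined for all large n *)
definition limsup_quotient :: "(nat \<Rightarrow> complex) \<Rightarrow> (nat \<Rightarrow> complex) \<Rightarrow> real \<Rightarrow> bool" where
  "limsup_quotient b a d \<longleftrightarrow>
     (\<forall>\<^sub>F n in sequentially. a n \<noteq> 0) \<and>
     limsup (\<lambda>n. ereal (cmod (b n / a n))) = ereal d"

definition coeff_ratio :: "(nat \<Rightarrow> complex) \<Rightarrow> (nat \<Rightarrow> complex) \<Rightarrow> nat \<Rightarrow> real" where
  "coeff_ratio a b n = (cmod (a n) + cmod (b n)) / (cmod (a (Suc n)) + cmod (b (Suc n)))"

end

theory Submission
  imports Defs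
begin

text \<open>Upper bounds. By Lewy's theorem a univalent harmonic mapping has a nonvanishing Jacobian, so
  \<open>f\<^sup>(\<^sup>n\<^sup>)\<close> (or its conjugate), rescaled from the disc of radius \<open>R\<^sub>n\<close> and normalised, belongs to
  \<open>S\<^sub>H\<close>. Reading off second coefficients bounds \<open>(n + 2) R\<^sub>n\<close> by \<open>2 (\<alpha> + \<beta>)\<close> times
  \<open>(|a\<^sub>n\<^sub>+\<^sub>1| + |b\<^sub>n\<^sub>+\<^sub>1|) / (|a\<^sub>n\<^sub>+\<^sub>2| + |b\<^sub>n\<^sub>+\<^sub>2|)\<close>; a larger lower limit would force a larger radius of
  convergence. For the geometric mean these inequalities, with maxima in place of sums, are multiplied up.

  Lower bounds. Put \<open>c\<^sub>m = |a\<^sub>m| + |b\<^sub>m|\<close>. If \<open>c\<^sub>m\<^sub>+\<^sub>j \<rho>\<^sup>j \<le> c\<^sub>m\<close> for \<open>m = n + 1\<close> and all \<open>j\<close>, then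
  comparison with the series of \<open>(1 - x)\<^sup>-\<^sup>m\<^sup>-\<^sup>1\<close> shows that the linear term of \<open>f\<^sup>(\<^sup>n\<^sup>)\<close> dominates on
  \<open>|z| < \<rho> x\<close> as long as \<open>(1 - x)\<^sup>-\<^sup>m\<^sup>-\<^sup>1 - 1 < (1 - \<delta>) / (1 + \<delta>)\<close>, which allows
  \<open>n x\<close> to approach \<open>ln (1 + (1 - \<delta>) / (1 + \<delta>))\<close>. For \<open>\<rho> < R\<^sub>f\<close> the decay holds for infinitely many
  \<open>m\<close> because \<open>c\<^sub>m \<rho>\<^sup>m\<close> tends to 0, and for all large \<open>m\<close> if the ratios are monotone.\<close>

section \<open>Lewy's theorem\<close>

text \<open>By the intermediate value theorem both functions take the value
  \<open>min (p e) (q e)\<close>, whose positivity keeps the parameters away from 0.\<close>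

lemma arcs_same_sign_meet:
  fixes p q :: "real \<Rightarrow> real"
  assumes "0 \<le> e" and "continuous_on {0..e} p" "continuous_on {0..e} q"
    and "p 0 = 0" "q 0 = 0" and "0 < p e" "0 < q e"
  obtains s t where "s \<in> {0<..e}" "t \<in> {0<..e}" "p s = q t"
proof -
  define y where "y = min (p e) (q e)"
  have y: "0 < y" "y \<le> p e" "y \<le> q e" using assms by (auto simp: y_def)
  obtain s where s: "0 \<le> s" "s \<le> e" "p s = y"
    using IVT'[of p 0 y e] assms y by (metis less_imp_le)
  obtain t where t: "0 \<le> t" "t \<le> e" "q t = y"
    using IVT'[of q 0 y e] assms y by (metis less_imp_le)
  have "s \<noteq> 0" "t \<noteq> 0" using s t y assms by auto
  then show ?thesis using that[of s t] s t by auto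
qed

text \<open>A point of a line has only two sides, so two of the three arcs end on the same side and
  share a value there.\<close>

lemma no_three_disjoint_arcs_in_line:
  fixes q :: "nat \<Rightarrow> real \<Rightarrow> real"
  assumes e: "0 < e"
    and cont: "\<And>k. continuous_on {0..e} (q k)"
    and q0: "\<And>k. q k 0 = 0"
    and nz: "\<And>k. k < 3 \<Longrightarrow> q k e \<noteq> 0"
    and disj: "\<And>k l s t. k < 3 \<Longrightarrow> l < 3 \<Longrightarrow> s \<in> {0<..e} \<Longrightarrow> t \<in> {0<..e} \<Longrightarrow> q k s = q l t \<Longrightarrow> k = l"
  shows False
proof -
  have pos: "\<not> (0 < q k e \<and> 0 < q l e)" if "k < 3" "l < 3" "k \<noteq> l" for k l
    using arcs_same_sign_meet[of e "q k" "q l"] e cont q0 disj that by (metis less_imp_le)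
  have neg: "\<not> (q k e < 0 \<and> q l e < 0)" if "k < 3" "l < 3" "k \<noteq> l" for k l
  proof
    assume "q k e < 0 \<and> q l e < 0"
    then obtain s t where "s \<in> {0<..e}" "t \<in> {0<..e}" "- q k s = - q l t"
      using arcs_same_sign_meet[of e "\<lambda>t. - q k t" "\<lambda>t. - q l t"] e q0
        continuous_on_minus[OF cont] by (metis less_imp_le neg_0_less_iff_less neg_0_equal_iff_equal)
    then show False using disj that by simp
  qed
  have "q 0 e \<noteq> 0" "q 1 e \<noteq> 0" "q 2 e \<noteq> 0" using nz by auto
  then show False using pos[of 0 1] pos[of 0 2] pos[of 1 2] neg[of 0 1] neg[of 0 2] neg[of 1 2]
    by auto
qed

text \<open>In a suitable holomorphic coordinate \<open>\<psi>\<close> is a constant plus \<open>w ^ n\<close> with \<open>n \<ge> 2\<close>, unless it is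
  constant, when any \<open>n\<close> will do. Either way the level set contains the rays \<open>Re (w ^ n) = 0\<close>.\<close>

lemma critical_point_chart:
  assumes hol: "\<psi> holomorphic_on S" and S: "open S" "z0 \<in> S" and crit: "deriv \<psi> z0 = 0"
  obtains \<eta> n e where "0 < e" "2 \<le> n" "continuous_on (cball 0 e) \<eta>" "inj_on \<eta> (cball 0 e)"
    "\<eta> ` cball 0 e \<subseteq> S" "\<eta> 0 = z0"
    "\<And>w. w \<in> cball 0 e \<Longrightarrow> Re (w ^ n) = 0 \<Longrightarrow> Re (\<psi> (\<eta> w)) = Re (\<psi> z0)"
proof (cases "\<forall>n>0. (deriv ^^ n) \<psi> z0 = 0")
  case True
  obtain r where r: "r > 0" "ball z0 r \<subseteq> S" using S by (blast elim!: openE)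
  have const: "\<psi> w = \<psi> z0" if "w \<in> ball z0 r" for w
    by (meson open_ball True r centre_in_ball connected_ball holomorphic_on_subset[OF hol]
              holomorphic_fun_eq_const_on_connected that)
  show ?thesis
  proof (rule that[of "r/2" 2 "\<lambda>w. z0 + w"])
    show "(+) z0 ` cball 0 (r / 2) \<subseteq> S" using r by (auto simp: dist_norm subset_iff)
    show "Re (\<psi> (z0 + w)) = Re (\<psi> z0)" if "w \<in> cball 0 (r/2)" for w
      using const[of "z0 + w"] that r by (auto simp: dist_norm)
  qed (use r in \<open>auto intro!: continuous_intros\<close>)
next
  case False
  then obtain n0 where n0: "n0 > 0 \<and> (deriv ^^ n0) \<psi> z0 \<noteq> 0" by blast
  define n where [abs_def]: "n = (LEAST n. n > 0 \<and> (deriv ^^ n) \<psi> z0 \<noteq> 0)"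
  have n_ne: "n > 0" "(deriv ^^ n) \<psi> z0 \<noteq> 0"
    using def_LeastI [OF n_def n0] by auto
  have n_min: "\<And>k. 0 < k \<Longrightarrow> k < n \<Longrightarrow> (deriv ^^ k) \<psi> z0 = 0"
    using def_Least_le [OF n_def] not_le by auto
  have n2: "2 \<le> n"
  proof (rule ccontr)
    assume "\<not> 2 \<le> n"
    then have "n = 1" using n_ne by simp
    then show False using n_ne crit by simp
  qed
  obtain g \<delta> where \<delta>: "0 < \<delta>" and holg: "g holomorphic_on ball z0 \<delta>"
    and fd: "\<And>w. w \<in> ball z0 \<delta> \<Longrightarrow> \<psi> w - \<psi> z0 = ((w - z0) * g w) ^ n"
    and gnz: "\<And>w. w \<in> ball z0 \<delta> \<Longrightarrow> g w \<noteq> 0"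
    by (blast intro: n_min holomorphic_factor_order_of_zero_strong [OF hol S n_ne])
  \<comment> \<open>\<open>\<phi>\<close> is an \<open>n\<close>-th root of
    \<open>\<psi> - \<psi> z0\<close> with a simple zero at \<open>z0\<close>, hence a local
    coordinate; its inverse is the chart \<open>\<eta>\<close>.\<close>
  define \<phi> where "\<phi> = (\<lambda>w. (w - z0) * g w)"
  have hol\<phi>: "\<phi> holomorphic_on ball z0 \<delta>"
    unfolding \<phi>_def by (intro holomorphic_intros holg)
  have "(g has_field_derivative deriv g z0) (at z0)"
    using holg \<delta> by (intro holomorphic_derivI[of _ "ball z0 \<delta>"]) auto
  then have "(\<phi> has_field_derivative g z0) (at z0)"
    unfolding \<phi>_def by (auto intro!: derivative_eq_intros)
  then have d\<phi>: "deriv \<phi> z0 \<noteq> 0"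
    using gnz[of z0] \<delta> DERIV_imp_deriv by force
  obtain r1 where r1: "r1 > 0" "ball z0 r1 \<subseteq> ball z0 \<delta>" "inj_on \<phi> (ball z0 r1)"
    using has_complex_derivative_locally_injective[OF hol\<phi>, of z0] d\<phi> \<delta> by auto
  obtain r2 where r2: "r2 > 0" "ball z0 r2 \<subseteq> S" using S by (blast elim!: openE)
  define B where "B = ball z0 (min r1 r2)"
  have B: "open B" "z0 \<in> B" "B \<subseteq> S" "B \<subseteq> ball z0 \<delta>" "inj_on \<phi> B"
    using r1 r2 by (auto simp: B_def intro: inj_on_subset)
  have hol\<phi>B: "\<phi> holomorphic_on B" using hol\<phi> B holomorphic_on_subset by blast
  have opn: "open (\<phi> ` B)" using open_mapping_thm3[OF hol\<phi>B] B by auto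
  obtain \<eta> where \<eta>: "\<eta> holomorphic_on (\<phi> ` B)" "\<And>z. z \<in> B \<Longrightarrow> \<eta> (\<phi> z) = z"
    using holomorphic_has_inverse[OF hol\<phi>B] B by metis
  have \<phi>0: "\<phi> z0 = 0" by (simp add: \<phi>_def)
  then have "0 \<in> \<phi> ` B" using B by force
  then obtain e where e: "e > 0" "cball 0 e \<subseteq> \<phi> ` B"
    using opn open_contains_cball by blast
  have \<eta>B: "\<eta> w \<in> B" "\<phi> (\<eta> w) = w" if "w \<in> cball 0 e" for w
    using e \<eta> that by (metis imageE subsetD)+
  show ?thesis
  proof (rule that[of e n \<eta>])
    show "inj_on \<eta> (cball 0 e)" using \<eta>B by (metis inj_onI)
    show "continuous_on (cball 0 e) \<eta>"
      using \<eta> e holomorphic_on_imp_continuous_on continuous_on_subset by blast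
    show "\<eta> 0 = z0" using \<eta>(2)[of z0] B \<phi>0 by simp
    show "Re (\<psi> (\<eta> w)) = Re (\<psi> z0)" if "w \<in> cball 0 e" "Re (w ^ n) = 0" for w
    proof -
      have "\<psi> (\<eta> w) - \<psi> z0 = w ^ n"
        using fd[of "\<eta> w"] \<eta>B[OF that(1)] B unfolding \<phi>_def by auto
      then have "Re (\<psi> (\<eta> w) - \<psi> z0) = 0" using that by simp
      then show ?thesis by simp
    qed
  qed (use e n2 \<eta>B B in auto)
qed

text \<open>If the Jacobian vanished at \<open>z0\<close>, then some \<open>Re (l * f)\<close> would have a critical point there,
  so three arcs of its level set would issue from \<open>z0\<close>, and \<open>f\<close> would map them injectively
  into a line.\<close>

theorem Lewy:
  assumes h: "h holomorphic_on S" and g: "g holomorphic_on S" and S: "open S"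
    and inj: "inj_on (\<lambda>z. h z + cnj (g z)) S" and z0: "z0 \<in> S"
  shows "cmod (deriv h z0) \<noteq> cmod (deriv g z0)"
proof
  assume eq: "cmod (deriv h z0) = cmod (deriv g z0)"
  obtain l where l: "cmod l = 1" "l * deriv h z0 + cnj l * deriv g z0 = 0"
  proof (cases "deriv h z0 = 0")
    case True
    then show ?thesis using that[of 1] eq by simp
  next
    case False
    \<comment> \<open>For unimodular \<open>l\<close> the equation amounts to
      \<open>l^2 = - g'(z0) / h'(z0)\<close>, whose right side has modulus 1 by
      \<open>eq\<close>.\<close>
    define u where "u = csqrt (- deriv g z0 / deriv h z0)"
    have u2: "u ^ 2 = - deriv g z0 / deriv h z0" by (simp add: u_def)
    moreover have "deriv g z0 \<noteq> 0" using eq False by auto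
    ultimately have "cmod u ^ 2 = 1" using eq False by (simp add: norm_divide flip: norm_power)
    then have u1: "cmod u = 1" using norm_ge_zero[of u] unfolding power2_eq_1_iff by linarith
    have "cnj u * u = 1" using u1 by (simp add: complex_norm_square[symmetric] mult.commute)
    moreover have "u \<noteq> 0" using u1 by auto
    ultimately have "cnj u = 1 / u" by (simp add: field_simps)
    with \<open>u \<noteq> 0\<close> have "u * deriv h z0 + cnj u * deriv g z0 = (u^2 * deriv h z0 + deriv g z0) / u"
      by (simp add: field_simps power2_eq_square)
    also have "\<dots> = 0" using u2 False by simp
    finally show ?thesis using that u1 by blast
  qed
  define f where "f = (\<lambda>z. h z + cnj (g z))"
  define \<psi> where "\<psi> = (\<lambda>z. l * h z + cnj l * g z)"
  have Re\<psi>: "Re (\<psi> z) = Re (l * f z)" for z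
    by (simp add: \<psi>_def f_def algebra_simps)
  have "(h has_field_derivative deriv h z0) (at z0)" "(g has_field_derivative deriv g z0) (at z0)"
    using h g S z0 holomorphic_derivI by blast+
  then have "(\<psi> has_field_derivative (l * deriv h z0 + cnj l * deriv g z0)) (at z0)"
    unfolding \<psi>_def by (auto intro!: derivative_eq_intros)
  then have crit: "deriv \<psi> z0 = 0" using l DERIV_imp_deriv by metis
  have "\<psi> holomorphic_on S" unfolding \<psi>_def by (intro holomorphic_intros h g)
  then obtain \<eta> n e where e: "0 < e" and n: "2 \<le> n" and cont\<eta>: "continuous_on (cball 0 e) \<eta>"
    and inj\<eta>: "inj_on \<eta> (cball 0 e)" and im\<eta>: "\<eta> ` cball 0 e \<subseteq> S" and \<eta>0: "\<eta> 0 = z0"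
    and lev: "\<And>w. w \<in> cball 0 e \<Longrightarrow> Re (w ^ n) = 0 \<Longrightarrow> Re (\<psi> (\<eta> w)) = Re (\<psi> z0)"
    using critical_point_chart[OF _ S z0 crit] by metis
  \<comment> \<open>Directions along which \<open>w ^ n\<close> is imaginary. As
    \<open>n \<ge> 2\<close>, the angles for \<open>k = 0, 1, 2\<close> stay in the range of
    \<open>Arg\<close>, which tells them apart.\<close>
  define c where "c = (\<lambda>k::nat. cis ((real k * pi - pi/2) / real n))"
  have cn: "Re (c k ^ n) = 0" for k
  proof -
    have "c k ^ n = cis (real k * pi - pi/2)" using n by (simp add: c_def Complex.DeMoivre)
    then show ?thesis by (simp add: cos_diff sin_npi)
  qed
  have c1: "cmod (c k) = 1" for k by (simp add: c_def)
  have cinj: "k = k'" if "c k = c k'" "k < 3" "k' < 3" for k k'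
  proof -
    have rng: "- pi < (real k * pi - pi/2) / real n" "(real k * pi - pi/2) / real n \<le> pi"
      if "k < 3" for k
    proof -
      have "pi * 2 \<le> pi * real n" "pi * real k \<le> pi * 2" "0 \<le> pi * real k"
        using n that by (auto intro!: mult_left_mono)
      then have "- (pi * real n) < pi * real k - pi/2 \<and> pi * real k - pi/2 \<le> pi * real n"
        using pi_gt_zero by linarith
      then show "- pi < (real k * pi - pi/2) / real n" "(real k * pi - pi/2) / real n \<le> pi"
        using n by (simp_all add: pos_less_divide_eq pos_divide_le_eq mult.commute)
    qed
    have "Arg (c k) = (real k * pi - pi/2) / real n" "Arg (c k') = (real k' * pi - pi/2) / real n"
      unfolding c_def using rng that by (auto intro!: Arg_cis)
    then have "(real k * pi - pi/2) / real n = (real k' * pi - pi/2) / real n" using that(1) by metis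
    then show ?thesis using n by simp
  qed
  define \<zeta> where "\<zeta> = (\<lambda>k t. \<eta> (of_real t * c k))"
  have mem: "of_real t * c k \<in> cball 0 e" if "t \<in> {0..e}" for t k
    using that c1 by (simp add: norm_mult)
  have \<zeta>S: "\<zeta> k t \<in> S" if "t \<in> {0..e}" for k t using im\<eta> mem[OF that] by (auto simp: \<zeta>_def)
  \<comment> \<open>The real part of \<open>l * f\<close> is constant on each arc
    (\<open>lvl\<close>), so \<open>q k\<close> is the position of the image on a vertical line,
    measured from \<open>l * f z0\<close>.\<close>
  define q where "q = (\<lambda>k t. Im (l * f (\<zeta> k t)) - Im (l * f z0))"
  have contf: "continuous_on S f"
    unfolding f_def using h g by (intro continuous_intros holomorphic_on_imp_continuous_on)
  have cont\<zeta>: "continuous_on {0..e} (\<zeta> k)" for k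
    unfolding \<zeta>_def by (rule continuous_on_compose2[OF cont\<eta>]) (use mem in \<open>auto intro!: continuous_intros\<close>)
  have contq: "continuous_on {0..e} (q k)" for k
    unfolding q_def
    by (intro continuous_intros continuous_on_compose2[OF contf cont\<zeta>]) (use \<zeta>S in auto)
  have lvl: "Re (l * f (\<zeta> k t)) = Re (l * f z0)" if "t \<in> {0..e}" for k t
  proof -
    have "Re ((of_real t * c k) ^ n) = 0" using cn[of k] 
      by (simp add: power_mult_distrib flip: of_real_power)
    then show ?thesis using lev[OF mem[OF that]] Re\<psi> by (simp add: \<zeta>_def)
  qed
  have key: "\<zeta> k s = \<zeta> k' t" if "s \<in> {0..e}" "t \<in> {0..e}" "q k s = q k' t" for k k' s t
  proof -
    have "l * f (\<zeta> k s) = l * f (\<zeta> k' t)"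
      using that lvl[of s k] lvl[of t k'] by (simp add: q_def complex_eq_iff)
    then have "f (\<zeta> k s) = f (\<zeta> k' t)" using l by auto
    then show ?thesis using inj \<zeta>S that unfolding f_def inj_on_def by blast
  qed
  have key2: "of_real s * c k = of_real t * c k'" if "s \<in> {0..e}" "t \<in> {0..e}" "q k s = q k' t" for k k' s t
    using key[OF that] inj\<eta> mem that unfolding \<zeta>_def inj_on_def by blast
  \<comment> \<open>The modulus recovers the parameter along a ray, so values of \<open>q\<close>
    agree only at the common origin or at the same point of the same ray.\<close>
  have key3: "s = t \<and> (s = 0 \<or> c k = c k')" if "s \<in> {0..e}" "t \<in> {0..e}" "q k s = q k' t" for k k' s t
  proof -
    have "cmod (of_real s * c k) = cmod (of_real t * c k')" using key2[OF that] by simp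
    then have "s = t" using that c1 by (simp add: norm_mult)
    then show ?thesis using key2[OF that] by auto
  qed
  have q0: "q k 0 = 0" for k using \<eta>0 by (simp add: q_def \<zeta>_def)
  show False
  proof (rule no_three_disjoint_arcs_in_line[of e q])
    show "q k e \<noteq> 0" for k using key3[of e 0 k k] q0[of k] e by auto
    show "k = k'" if "k < 3" "k' < 3" "s \<in> {0<..e}" "t \<in> {0<..e}" "q k s = q k' t" for k k' s t
      using key3[of s t k k'] that cinj by auto
  qed (use e contq q0 in auto)
qed

section \<open>Second coefficients of the derivatives\<close>

text \<open>By Lewy's theorem the continuous difference of the two moduli has no zero, so it keeps
  its sign on a connected set.\<close>

lemma univalent_harmonic_orientation:
  assumes h: "h holomorphic_on S" and g: "g holomorphic_on S" and S: "open S" "connected S"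
    and inj: "inj_on (\<lambda>z. h z + cnj (g z)) S"
  shows "(\<forall>z\<in>S. cmod (deriv g z) < cmod (deriv h z)) \<or> (\<forall>z\<in>S. cmod (deriv h z) < cmod (deriv g z))"
proof (rule ccontr)
  define J where "J = (\<lambda>z. cmod (deriv h z) - cmod (deriv g z))"
  have nz: "J z \<noteq> 0" if "z \<in> S" for z using Lewy[OF h g S(1) inj that] by (simp add: J_def)
  assume "\<not> ?thesis"
  then obtain z w where "z \<in> S" "w \<in> S" "J z \<le> 0" "0 \<le> J w" by (force simp: J_def not_less)
  moreover have "continuous_on S J" unfolding J_def
    by (intro continuous_intros holomorphic_on_imp_continuous_on holomorphic_deriv h g S)
  then have "connected (J ` S)" by (rule connected_continuous_image[OF _ S(2)])
  ultimately have "0 \<in> J ` S" by (meson connectedD_interval image_eqI)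
  then show False using nz by auto
qed

text \<open>The Taylor series at 0 of \<open>z \<mapsto> (p (r * z) - p 0) / c\<close>.\<close>

definition rescaled_fps :: "complex \<Rightarrow> real \<Rightarrow> complex fps \<Rightarrow> complex fps" where
  "rescaled_fps c r p = Abs_fps (\<lambda>k. if k = 0 then 0 else fps_nth p k * of_real r ^ k / c)"

lemma rescaled_fps_sums:
  assumes r: "0 < r" "ereal r \<le> fps_conv_radius p" and z: "cmod z < 1"
  shows "(\<lambda>k. fps_nth (rescaled_fps c r p) k * z ^ k) sums
    ((eval_fps p (of_real r * z) - fps_nth p 0) / c)"
proof -
  have "r * cmod z < r" using r z by simp
  then have "ereal (cmod (of_real r * z)) < fps_conv_radius p"
    using r by (simp add: norm_mult less_le_trans[of "ereal (r * cmod z)" "ereal r"])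
  then have "(\<lambda>k. fps_nth p k * (of_real r * z) ^ k) sums eval_fps p (of_real r * z)"
    by (rule sums_eval_fps)
  from sums_divide[OF sums_diff[OF this sums_single[of 0 "\<lambda>k. fps_nth p k"]], of c]
  show ?thesis
    by (rule sums_cong[THEN iffD1, rotated]) (auto simp: rescaled_fps_def power_mult_distrib)
qed

lemma eval_rescaled_fps:
  assumes "0 < r" "ereal r \<le> fps_conv_radius p" and "cmod z < 1"
  shows "eval_fps (rescaled_fps c r p) z = (eval_fps p (of_real r * z) - fps_nth p 0) / c"
  using sums_unique[OF rescaled_fps_sums[OF assms, of c]] by (simp add: eval_fps_def)

lemma conv_radius_rescaled_fps:
  assumes "0 < r" "ereal r \<le> fps_conv_radius p"
  shows "fps_conv_radius (rescaled_fps c r p) \<ge> 1"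
  unfolding fps_conv_radius_def
  by (rule conv_radius_geI_ex')
    (rule sums_summable, rule rescaled_fps_sums[OF assms], auto)

lemma deriv_rescaled_fps:
  assumes r: "0 < r" "ereal r \<le> fps_conv_radius p" and z: "cmod z < 1"
  shows "deriv (eval_fps (rescaled_fps c r p)) z = of_real r * deriv (eval_fps p) (of_real r * z) / c"
proof -
  have "r * cmod z < r" using r z by simp
  then have *: "ereal (cmod (of_real r * z)) < fps_conv_radius p"
    using r by (simp add: norm_mult less_le_trans[of "ereal (r * cmod z)" "ereal r"])
  have "(eval_fps p has_field_derivative deriv (eval_fps p) (of_real r * z)) (at (of_real r * z))"
    using has_field_derivative_eval_fps[OF *] eval_fps_deriv[OF *] by simp
  then have "((\<lambda>z. eval_fps p (of_real r * z)) has_field_derivative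
      deriv (eval_fps p) (of_real r * z) * of_real r) (at z)"
    by (rule DERIV_chain2) (auto intro!: derivative_eq_intros)
  then have "((\<lambda>z. (eval_fps p (of_real r * z) - fps_nth p 0) / c) has_field_derivative
      of_real r * deriv (eval_fps p) (of_real r * z) / c) (at z)"
    by (intro DERIV_cdivide) (auto dest: DERIV_diff[OF _ DERIV_const] simp: mult.commute)
  then have "(eval_fps (rescaled_fps c r p) has_field_derivative
      of_real r * deriv (eval_fps p) (of_real r * z) / c) (at z)"
    by (rule has_field_derivative_transform_within_open[of _ _ _ "ball 0 1"])
      (use z in \<open>auto simp: eval_rescaled_fps[OF r]\<close>)
  then show ?thesis by (rule DERIV_imp_deriv)
qed

text \<open>With divisors \<open>c\<close> and \<open>cnj c\<close> the pair represents the single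
  map \<open>(f (r * z) - f 0) / c\<close>, which inherits injectivity from \<open>f\<close>. The
  choice \<open>c = r * p'(0)\<close> makes the leading coefficient 1.\<close>

lemma rescaled_univalent_in_S_H:
  assumes r: "0 < r" and p: "ereal r \<le> fps_conv_radius p" and q: "ereal r \<le> fps_conv_radius q"
    and inj: "inj_on (\<lambda>z. eval_fps p z + cnj (eval_fps q z)) (ball 0 r)"
    and sense: "\<And>z. z \<in> ball 0 r \<Longrightarrow> cmod (deriv (eval_fps q) z) < cmod (deriv (eval_fps p) z)"
  defines "c \<equiv> fps_nth p 1 * of_real r"
  shows "fps_nth p 1 \<noteq> 0" and "(rescaled_fps c r p, rescaled_fps (cnj c) r q) \<in> S_H"
proof -
  have "0 < fps_conv_radius p" using r p by (metis ereal_less(2) less_le_trans)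
  then have "deriv (eval_fps p) 0 = fps_nth p 1" using fps_nth_conv_deriv[of p 1] by simp
  then show p1: "fps_nth p 1 \<noteq> 0" using sense[of 0] r by auto
  then have c: "c \<noteq> 0" using r by (simp add: c_def)
  let ?H = "rescaled_fps c r p" and ?G = "rescaled_fps (cnj c) r q"
  note eH = eval_rescaled_fps[OF r p] and eG = eval_rescaled_fps[OF r q]
  have bp: "ball 0 r \<subseteq> eball 0 (fps_conv_radius p)" and bq: "ball 0 r \<subseteq> eball 0 (fps_conv_radius q)"
    by (intro ball_eball_mono p q)+
  have b1: "ball 0 1 \<subseteq> eball 0 (fps_conv_radius ?H)" "ball 0 1 \<subseteq> eball 0 (fps_conv_radius ?G)"
    using conv_radius_rescaled_fps[OF r p, of c] conv_radius_rescaled_fps[OF r q, of "cnj c"]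
    by (auto intro!: ball_eball_mono simp: one_ereal_def)
  have inr: "of_real r * z \<in> ball 0 r" if "z \<in> ball 0 1" for z :: complex
    using that r by (simp add: norm_mult)
  have F: "eval_fps ?H z + cnj (eval_fps ?G z) =
      (eval_fps p (of_real r * z) + cnj (eval_fps q (of_real r * z)) - (fps_nth p 0 + cnj (fps_nth q 0))) / c"
    if "z \<in> ball 0 1" for z
    using that by (simp add: eH eG add_divide_distrib diff_divide_distrib)
  have injF: "inj_on (\<lambda>z. eval_fps ?H z + cnj (eval_fps ?G z)) (ball 0 1)"
  proof (rule inj_onI)
    fix z w :: complex assume zw: "z \<in> ball 0 1" "w \<in> ball 0 1"
      and "eval_fps ?H z + cnj (eval_fps ?G z) = eval_fps ?H w + cnj (eval_fps ?G w)"
    then have "eval_fps p (of_real r * z) + cnj (eval_fps q (of_real r * z)) =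
        eval_fps p (of_real r * w) + cnj (eval_fps q (of_real r * w))"
      using c by (simp add: F)
    then have "of_real r * z = of_real r * w" using inj inr zw unfolding inj_on_def by blast
    then show "z = w" using r by simp
  qed
  \<comment> \<open>The two different divisors rotate the dilatation by the unimodular factor
    \<open>c / cnj c\<close>.\<close>
  define \<omega> where "\<omega> = (\<lambda>z. c / cnj c * (deriv (eval_fps q) (of_real r * z) / deriv (eval_fps p) (of_real r * z)))"
  have dhol: "(\<lambda>z. deriv (eval_fps u) (of_real r * z)) holomorphic_on ball 0 1"
    if "ball (0::complex) r \<subseteq> eball 0 (fps_conv_radius u)" for u :: "complex fps"
  proof -
    have "deriv (eval_fps u) holomorphic_on ball 0 r"
      using holomorphic_on_eval_fps[OF that] by (intro holomorphic_deriv) auto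
    moreover have "(\<lambda>z. of_real r * z) holomorphic_on ball 0 1"
      by (intro holomorphic_intros)
    ultimately have "(deriv (eval_fps u) \<circ> (\<lambda>z. of_real r * z)) holomorphic_on ball 0 1"
      using inr by (intro holomorphic_on_compose_gen[of _ _ _ "ball 0 r"]) auto
    then show ?thesis by (simp add: o_def)
  qed
  have dpnz: "deriv (eval_fps p) (of_real r * z) \<noteq> 0" if "z \<in> ball 0 1" for z
    using sense[OF inr[OF that]] by auto
  have "\<omega> holomorphic_on ball 0 1"
    unfolding \<omega>_def by (intro holomorphic_intros dhol bp bq dpnz) 
  moreover have "cmod (\<omega> z) < 1 \<and> deriv (eval_fps ?G) z = \<omega> z * deriv (eval_fps ?H) z"
    if z: "z \<in> ball 0 1" for z
  proof
    show "cmod (\<omega> z) < 1"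
      using sense[OF inr[OF z]] c by (simp add: \<omega>_def norm_divide norm_mult divide_less_eq)
    show "deriv (eval_fps ?G) z = \<omega> z * deriv (eval_fps ?H) z"
      using z c dpnz[OF z] by (simp add: \<omega>_def deriv_rescaled_fps[OF r p] deriv_rescaled_fps[OF r q])
  qed
  moreover have "\<not> (\<lambda>z. eval_fps ?H z + cnj (eval_fps ?G z)) constant_on ball 0 1"
  proof
    assume "(\<lambda>z. eval_fps ?H z + cnj (eval_fps ?G z)) constant_on ball 0 1"
    then have "ball (0::complex) 1 = {}" by (rule injective_not_constant[OF open_ball injF])
    then show False by simp
  qed
  ultimately have "sense_preserving_harmonic_on (ball 0 1) (eval_fps ?H) (eval_fps ?G)"
    unfolding sense_preserving_harmonic_on_def
    using holomorphic_on_eval_fps[OF b1(1)] holomorphic_on_eval_fps[OF b1(2)] by blast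
  moreover have "fps_nth ?H 0 = 0" "fps_nth ?H 1 = 1" "fps_nth ?G 0 = 0"
    using c by (simp_all add: rescaled_fps_def c_def)
  ultimately show "(?H, ?G) \<in> S_H"
    unfolding S_H_def mem_Collect_eq prod.case
    using injF conv_radius_rescaled_fps[OF r p] conv_radius_rescaled_fps[OF r q] by (intro conjI)
qed

text \<open>The normalised pair has second coefficients \<open>r * p_2 / p_1\<close> and
  \<open>r * q_2 / cnj p_1\<close>; hence \<open>p_1\<close> occurs in both bounds.\<close>

lemma sense_preserving_univalent_second_coeff:
  assumes r: "0 < r" and p: "ereal r \<le> fps_conv_radius p" and q: "ereal r \<le> fps_conv_radius q"
    and inj: "inj_on (\<lambda>z. eval_fps p z + cnj (eval_fps q z)) (ball 0 r)"
    and sense: "\<And>z. z \<in> ball 0 r \<Longrightarrow> cmod (deriv (eval_fps q) z) < cmod (deriv (eval_fps p) z)"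
    and fin: "alpha_H = ereal A" "beta_H = ereal B"
  shows "r * cmod (fps_nth p 2) \<le> A * cmod (fps_nth p 1)"
    and "r * cmod (fps_nth q 2) \<le> B * cmod (fps_nth p 1)"
proof -
  note * = rescaled_univalent_in_S_H[OF r p q inj sense]
  have "ereal (cmod (fps_nth p 2 * of_real r ^ 2 / (fps_nth p 1 * of_real r))) \<le> alpha_H"
    unfolding alpha_H_def using *(2) by (intro SUP_upper2[OF *(2)]) (auto simp: rescaled_fps_def)
  then show "r * cmod (fps_nth p 2) \<le> A * cmod (fps_nth p 1)"
    using r *(1) by (simp add: fin norm_mult norm_divide norm_power divide_le_eq power2_eq_square mult_ac)
  have "ereal (cmod (fps_nth q 2 * of_real r ^ 2 / cnj (fps_nth p 1 * of_real r))) \<le> beta_H"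
    unfolding beta_H_def using *(2) by (intro SUP_upper2[OF *(2)]) (auto simp: rescaled_fps_def)
  then show "r * cmod (fps_nth q 2) \<le> B * cmod (fps_nth p 1)"
    using r *(1) by (simp add: fin norm_mult norm_divide norm_power divide_le_eq power2_eq_square mult_ac)
qed

text \<open>The alternatives are the two orientations. A sense-reversing map is conjugated, which
  exchanges \<open>p\<close> and \<open>q\<close>.\<close>

lemma univalent_second_coeff:
  assumes r: "0 < r" and p: "ereal r \<le> fps_conv_radius p" and q: "ereal r \<le> fps_conv_radius q"
    and inj: "inj_on (\<lambda>z. eval_fps p z + cnj (eval_fps q z)) (ball 0 r)"
    and fin: "alpha_H = ereal A" "beta_H = ereal B"
  shows "r * cmod (fps_nth p 2) \<le> A * cmod (fps_nth p 1) \<and> r * cmod (fps_nth q 2) \<le> B * cmod (fps_nth p 1)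
    \<or> r * cmod (fps_nth q 2) \<le> A * cmod (fps_nth q 1) \<and> r * cmod (fps_nth p 2) \<le> B * cmod (fps_nth q 1)"
proof -
  have "eval_fps p holomorphic_on ball 0 r" "eval_fps q holomorphic_on ball 0 r"
    using p q by (auto intro!: holomorphic_on_eval_fps ball_eball_mono)
  note orient = univalent_harmonic_orientation[OF this open_ball connected_ball inj]
  have "inj_on (cnj \<circ> (\<lambda>z. eval_fps p z + cnj (eval_fps q z))) (ball 0 r)"
    by (intro comp_inj_on[OF inj] inj_onI) simp
  then have inj': "inj_on (\<lambda>z. eval_fps q z + cnj (eval_fps p z)) (ball 0 r)"
    by (simp add: o_def add.commute)
  from orient show ?thesis
    using sense_preserving_univalent_second_coeff[OF r p q inj _ fin]
      sense_preserving_univalent_second_coeff[OF r q p inj' _ fin] by blast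
qed

section \<open>Power series of the higher derivatives\<close>

lemma conv_radius_higher_fps_deriv:
  fixes f :: "complex fps"
  shows "fps_conv_radius f \<le> fps_conv_radius ((fps_deriv ^^ n) f)"
  by (induction n) (auto intro: order_trans fps_conv_radius_deriv)

lemma higher_deriv_eval_fps:
  fixes f :: "complex fps"
  assumes "ereal (cmod z) < fps_conv_radius f"
  shows "(deriv ^^ n) (eval_fps f) z = eval_fps ((fps_deriv ^^ n) f) z"
  using assms
proof (induction n arbitrary: z)
  case (Suc n)
  let ?F = "(fps_deriv ^^ n) f"
  have z: "ereal (cmod z) < fps_conv_radius ?F"
    using Suc.prems conv_radius_higher_fps_deriv less_le_trans by blast
  have "(eval_fps ?F has_field_derivative eval_fps (fps_deriv ?F) z) (at z)"
    using has_field_derivative_eval_fps[OF z] .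
  then have "((deriv ^^ n) (eval_fps f) has_field_derivative eval_fps (fps_deriv ?F) z) (at z)"
    by (rule has_field_derivative_transform_within_open[of _ _ _ "eball 0 (fps_conv_radius f)"])
      (use Suc in auto)
  then show ?case by (simp add: DERIV_imp_deriv)
qed simp

lemma fps_nth_higher_deriv:
  fixes f :: "complex fps"
  shows "fps_nth ((fps_deriv ^^ n) f) k = fact (n + k) / fact k * fps_nth f (n + k)"
proof (induction n arbitrary: k)
  case (Suc n)
  have "fps_nth ((fps_deriv ^^ Suc n) f) k = of_nat (Suc k) * (fact (n + Suc k) / fact (Suc k) * fps_nth f (n + Suc k))"
    using Suc[of "Suc k"] by simp
  also have "\<dots> = fact (Suc n + k) / fact k * fps_nth f (Suc n + k)"
    by (simp add: divide_simps del: of_nat_Suc)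
  finally show ?case .
qed simp

lemma harm_deriv_eq:
  assumes "ereal (cmod z) < harm_conv_radius h g"
  shows "harm_deriv n h g z = eval_fps ((fps_deriv ^^ n) h) z + cnj (eval_fps ((fps_deriv ^^ n) g) z)"
  using assms by (simp add: harm_deriv_def harm_conv_radius_def higher_deriv_eval_fps)

lemma harm_conv_radius_higher_deriv:
  assumes "r \<le> harm_conv_radius h g"
  shows "r \<le> fps_conv_radius ((fps_deriv ^^ n) h)" "r \<le> fps_conv_radius ((fps_deriv ^^ n) g)"
  using assms order_trans[OF _ conv_radius_higher_fps_deriv] by (auto simp: harm_conv_radius_def)

text \<open>The coefficients 1 and 2 of the \<open>n\<close>-th derivative are those of index
  \<open>n + 1\<close> and \<open>n + 2\<close> times \<open>(n + 1)!\<close> and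
  \<open>(n + 2)! / 2\<close>. The quotient of these factors is \<open>(n + 2) / 2\<close>.\<close>

lemma univalent_harm_deriv_coeffs:
  assumes r: "0 < r" "ereal r \<le> harm_conv_radius h g"
    and inj: "inj_on (harm_deriv n h g) (ball 0 r)"
    and fin: "alpha_H = ereal A" "beta_H = ereal B"
  defines "a \<equiv> \<lambda>k. cmod (fps_nth h k)" and "b \<equiv> \<lambda>k. cmod (fps_nth g k)"
  shows "(real n + 2) * r * a (n + 2) \<le> 2 * A * a (n + 1) \<and> (real n + 2) * r * b (n + 2) \<le> 2 * B * a (n + 1)
    \<or> (real n + 2) * r * b (n + 2) \<le> 2 * A * b (n + 1) \<and> (real n + 2) * r * a (n + 2) \<le> 2 * B * b (n + 1)"
proof -
  let ?p = "(fps_deriv ^^ n) h" and ?q = "(fps_deriv ^^ n) g"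
  have "ereal (cmod z) < harm_conv_radius h g" if "z \<in> ball 0 r" for z
    using that r by (auto intro: less_le_trans[of _ "ereal r"])
  then have "inj_on (\<lambda>z. eval_fps ?p z + cnj (eval_fps ?q z)) (ball 0 r)"
    using inj harm_deriv_eq by (auto simp: inj_on_def)
  note * = univalent_second_coeff[OF r(1) harm_conv_radius_higher_deriv[OF r(2)] this fin]
  have c1: "cmod (fps_nth ((fps_deriv ^^ n) u) 1) = fact (n + 1) * cmod (fps_nth u (n + 1))" for u :: "complex fps"
    by (simp add: fps_nth_higher_deriv norm_mult norm_fact flip: fact_Suc)
  have c2: "cmod (fps_nth ((fps_deriv ^^ n) u) 2) = fact (n + 1) * (real n + 2) / 2 * cmod (fps_nth u (n + 2))"
    for u :: "complex fps"
  proof -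
    have "(fact (n + 2) :: complex) = of_real (fact (n + 1) * (real n + 2))"
      by (simp add: algebra_simps)
    then show ?thesis by (simp only: fps_nth_higher_deriv norm_mult norm_divide norm_of_real) simp
  qed
  have scale: "(real n + 2) * r * x \<le> 2 * C * y"
    if "r * (fact (n + 1) * (real n + 2) / 2 * x) \<le> C * (fact (n + 1) * y)" for x y C :: real
  proof -
    have "fact (n + 1) * ((real n + 2) * r * x) \<le> fact (n + 1) * (2 * C * y)"
      using that by (simp only: field_simps)
    then show ?thesis by (simp del: fact_Suc)
  qed
  show ?thesis using * unfolding c1 c2 a_def b_def using scale by blast
qed

section \<open>The radius of univalence and neighbouring coefficients\<close>

lemma univalence_radius_attained:
  "inj_on (harm_deriv n h g) (eball 0 (univalence_radius n h g))"
proof (rule inj_onI)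
  fix z w assume zw: "z \<in> eball 0 (univalence_radius n h g)" "w \<in> eball 0 (univalence_radius n h g)"
    and eq: "harm_deriv n h g z = harm_deriv n h g w"
  then have "ereal (max (cmod z) (cmod w)) < univalence_radius n h g" by (auto simp: max_def)
  then obtain r where "ereal (max (cmod z) (cmod w)) < r" "inj_on (harm_deriv n h g) (eball 0 r)"
    unfolding univalence_radius_def less_Sup_iff by auto
  moreover from this have "z \<in> eball 0 r" "w \<in> eball 0 r"
    by (auto intro: le_less_trans[of _ "ereal (max (cmod z) (cmod w))"])
  ultimately show "z = w" using eq by (auto simp: inj_on_def)
qed

lemma univalence_radius_ge_0: "0 \<le> harm_conv_radius h g \<Longrightarrow> 0 \<le> univalence_radius n h g"
  unfolding univalence_radius_def by (rule Sup_upper) auto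

lemma univalence_radius_le: "univalence_radius n h g \<le> harm_conv_radius h g"
  unfolding univalence_radius_def by (rule Sup_least) auto

lemma univalence_radius_geI:
  assumes "0 \<le> r" "ereal r \<le> harm_conv_radius h g" "inj_on (harm_deriv n h g) (ball 0 r)"
  shows "ereal r \<le> univalence_radius n h g"
  unfolding univalence_radius_def by (rule Sup_upper) (use assms in auto)

text \<open>Sums and maxima treat \<open>a\<close> and \<open>b\<close> alike, so the case
  distinction on the orientation disappears. The sum leads to the constant \<open>A + B\<close>, the
  maximum to \<open>max A B\<close>.\<close>

lemma univalence_radius_coeffs:
  assumes rf: "harm_conv_radius h g = ereal \<rho>" "0 \<le> \<rho>"
    and fin: "alpha_H = ereal A" "beta_H = ereal B" and AB: "0 \<le> A" "0 \<le> B"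
  defines "a \<equiv> \<lambda>k. cmod (fps_nth h k)" and "b \<equiv> \<lambda>k. cmod (fps_nth g k)"
  obtains r where "univalence_radius n h g = ereal r" "0 \<le> r"
    "(real n + 2) * r * (a (n + 2) + b (n + 2)) \<le> 2 * (A + B) * (a (n + 1) + b (n + 1))"
    "(real n + 2) * r * max (a (n + 2)) (b (n + 2)) \<le> 2 * max A B * max (a (n + 1)) (b (n + 1))"
proof -
  obtain r where r: "univalence_radius n h g = ereal r" "0 \<le> r"
    using univalence_radius_ge_0[of h g n] univalence_radius_le[of n h g] rf
    by (cases "univalence_radius n h g") auto
  have nn: "0 \<le> a k" "0 \<le> b k" for k by (auto simp: a_def b_def)
  show ?thesis
  proof (cases "r = 0")
    \<comment> \<open>Without a disc of univalence there is nothing to rescale, but the left sides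
      of both inequalities are 0.\<close>
    case True
    show ?thesis by (rule that[OF r]) (use True AB nn in \<open>auto simp: max_def\<close>)
  next
    case False
    then have "0 < r" using r by simp
    have le: "ereal r \<le> harm_conv_radius h g" using univalence_radius_le[of n h g] r by simp
    have "inj_on (harm_deriv n h g) (ball 0 r)"
      using univalence_radius_attained[of n h g] r by simp
    note univalent_harm_deriv_coeffs[OF \<open>0 < r\<close> le this fin]
    then have *: "(real n + 2) * r * a (n + 2) \<le> 2 * A * a (n + 1) \<and> (real n + 2) * r * b (n + 2) \<le> 2 * B * a (n + 1)
      \<or> (real n + 2) * r * b (n + 2) \<le> 2 * A * b (n + 1) \<and> (real n + 2) * r * a (n + 2) \<le> 2 * B * b (n + 1)"
      by (simp only: a_def b_def)
    let ?n = "(real n + 2) * r"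
    have m: "C * x \<le> max A B * max (a (n + 1)) (b (n + 1))"
      if "C = A \<or> C = B" "x = a (n + 1) \<or> x = b (n + 1)" for C x
      by (rule mult_mono) (use that AB nn[of "n+1"] in auto)
    have s: "C * x \<le> C * (a (n + 1) + b (n + 1))"
      if "C = A \<or> C = B" "x = a (n + 1) \<or> x = b (n + 1)" for C x
      by (rule mult_left_mono) (use that AB nn[of "n+1"] in auto)
    have 1: "?n * (a (n + 2) + b (n + 2)) \<le> 2 * (A + B) * (a (n + 1) + b (n + 1))"
      using * s[of A "a (n+1)"] s[of A "b (n+1)"] s[of B "a (n+1)"] s[of B "b (n+1)"]
      by (auto simp: distrib_left distrib_right)
    have 2: "?n * a (n + 2) \<le> 2 * max A B * max (a (n + 1)) (b (n + 1))"
        "?n * b (n + 2) \<le> 2 * max A B * max (a (n + 1)) (b (n + 1))"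
      using * m[of A "a (n+1)"] m[of A "b (n+1)"] m[of B "a (n+1)"] m[of B "b (n+1)"] by auto
    show ?thesis by (rule that[OF r 1]) (use 2 in \<open>auto simp: max_def\<close>)
  qed
qed

section \<open>Upper bounds\<close>

lemma fps_conv_radius_geI:
  fixes p :: "complex fps"
  assumes q: "0 < q" and ev: "eventually (\<lambda>n. cmod (fps_nth p n) \<le> C * q ^ n) sequentially"
  shows "ereal (1 / q) \<le> fps_conv_radius p"
  unfolding fps_conv_radius_def
proof (rule conv_radius_geI_ex')
  fix s :: real assume s: "0 < s" "ereal s < ereal (1 / q)"
  have "norm (q * s) < 1" using s q by (simp add: field_simps)
  then have "summable (\<lambda>n. C * (q * s) ^ n)" by (intro summable_mult summable_geometric)
  moreover have "eventually (\<lambda>n. norm (fps_nth p n * of_real s ^ n) \<le> C * (q * s) ^ n) sequentially"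
    using ev
  proof eventually_elim
    case (elim n)
    then have "cmod (fps_nth p n) * s ^ n \<le> (C * q ^ n) * s ^ n"
      using s by (intro mult_right_mono) auto
    then show ?case using s by (simp add: norm_mult norm_power power_mult_distrib mult.assoc)
  qed
  ultimately show "summable (\<lambda>n. fps_nth p n * of_real s ^ n)"
    by (rule summable_comparison_test_ev[rotated])
qed

lemma harm_conv_radius_geI:
  assumes q: "0 < q" and M: "\<And>k. cmod (fps_nth h (M + k)) \<le> C * q ^ k" "\<And>k. cmod (fps_nth g (M + k)) \<le> C * q ^ k"
  shows "ereal (1 / q) \<le> harm_conv_radius h g"
proof -
  have *: "eventually (\<lambda>n. cmod (fps_nth u n) \<le> (C / q ^ M) * q ^ n) sequentially"
    if "\<And>k. cmod (fps_nth u (M + k)) \<le> C * q ^ k" for u :: "complex fps"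
    using eventually_ge_at_top[of M]
  proof eventually_elim
    case (elim n)
    then have "cmod (fps_nth u n) \<le> C * q ^ (n - M)" using that[of "n - M"] by simp
    also have "\<dots> = (C / q ^ M) * q ^ n" using elim q by (simp add: power_diff)
    finally show ?case .
  qed
  show ?thesis
    using fps_conv_radius_geI[OF q *[of h]] fps_conv_radius_geI[OF q *[of g]] M
    by (simp add: harm_conv_radius_def)
qed

lemma S_H_harm_conv_radius: "(h, g) \<in> S_H \<Longrightarrow> 1 \<le> harm_conv_radius h g"
  by (simp add: S_H_def harm_conv_radius_def)

text \<open>Witnessed by \<open>z + z\<^sup>2 / 4\<close>. If \<open>alpha_H\<close> vanished, the upper bounds could degenerate
  to \<open>0 * \<infinity> = 0\<close> for entire \<open>h\<close> and \<open>g\<close>.\<close>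

lemma alpha_H_pos: "0 < alpha_H"
proof -
  let ?p = "fps_of_poly [:0, 1, 1/4 :: complex:]"
  have e: "eval_fps ?p z + cnj (eval_fps 0 z) = z * (1 + z / 4)" for z by simp
  have "inj_on (\<lambda>z::complex. z * (1 + z / 4)) (ball 0 1)"
  proof (rule inj_onI)
    fix z w :: complex assume "z \<in> ball 0 1" "w \<in> ball 0 1" "z * (1 + z / 4) = w * (1 + w / 4)"
    then have "cmod (z + w) < 2" and eq: "z * (1 + z / 4) - w * (1 + w / 4) = 0"
      using norm_triangle_ineq[of z w] by auto
    then have "z + w \<noteq> - 4" by auto
    then have "1 + (z + w) / 4 \<noteq> 0" by (simp add: field_simps eq_neg_iff_add_eq_0)
    moreover have "(z - w) * (1 + (z + w) / 4) = 0"
      unfolding eq[symmetric] by (simp add: field_simps)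
    ultimately show "z = w" by simp
  qed
  then have inj: "inj_on (\<lambda>z. eval_fps ?p z + cnj (eval_fps 0 z)) (ball 0 1)" unfolding e .
  have d: "cmod (deriv (eval_fps 0) z) < cmod (deriv (eval_fps ?p) z)" if "z \<in> ball 0 1" for z
  proof -
    have "((\<lambda>z::complex. z * (1 + z / 4)) has_field_derivative 1 + z / 2) (at z)"
      by (auto intro!: derivative_eq_intros simp: field_simps)
    moreover have "eval_fps ?p = (\<lambda>z. z * (1 + z / 4))" by auto
    ultimately have "(eval_fps ?p has_field_derivative 1 + z / 2) (at z)" by simp
    then have "deriv (eval_fps ?p) z = 1 + z / 2" by (rule DERIV_imp_deriv)
    moreover have "1 + z / 2 \<noteq> 0"
    proof
      assume "1 + z / 2 = 0"
      then have "z = - 2" by (simp add: field_simps eq_neg_iff_add_eq_0)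
      then show False using that by simp
    qed
    moreover have "eval_fps 0 = (\<lambda>z::complex. 0)" by auto
    ultimately show ?thesis by simp
  qed
  note S = rescaled_univalent_in_S_H(2)[of 1 ?p 0, OF _ _ _ inj d]
  have "ereal (1/4) \<le> alpha_H"
    unfolding alpha_H_def by (rule SUP_upper2[OF S]) (auto simp: rescaled_fps_def numeral_2_eq_2)
  then show ?thesis by (rule less_le_trans[rotated]) simp
qed

lemma beta_H_nonneg: "(h, g) \<in> S_H \<Longrightarrow> 0 \<le> beta_H"
  unfolding beta_H_def by (rule SUP_upper2) auto

lemma geometric_decay_iterate:
  fixes c :: "nat \<Rightarrow> real"
  assumes "0 \<le> q" "\<And>n. n \<ge> M \<Longrightarrow> c (Suc n) \<le> q * c n"
  shows "c (M + k) \<le> c M * q ^ k"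
proof (induction k)
  case (Suc k)
  have "c (M + Suc k) \<le> q * c (M + k)" using assms(2)[of "M + k"] by simp
  also have "\<dots> \<le> q * (c M * q ^ k)" using Suc assms by (intro mult_left_mono) auto
  finally show ?case by (simp add: mult_ac)
qed simp

text \<open>\<open>n^n / n!\<close> is a single term of the nonnegative series of
  \<open>exp n\<close>. This is the source of the factor \<open>e\<close> in the bound for the
  geometric mean.\<close>

lemma power_self_le_exp_fact: "real n ^ n \<le> exp (real n) * fact n"
proof -
  have s: "(\<lambda>k. real n ^ k /\<^sub>R fact k) sums exp (real n)" by (rule exp_converges)
  have "(\<Sum>k\<in>{n}. real n ^ k /\<^sub>R fact k) \<le> (\<Sum>k. real n ^ k /\<^sub>R fact k)"
    using s by (intro sum_le_suminf) (auto simp: sums_iff)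
  then show ?thesis using s by (simp add: sums_iff field_simps)
qed

text \<open>The case in which real arithmetic applies. If one of the three quantities is infinite,
  the upper bounds are infinite too.\<close>

locale finite_harmonic =
  fixes h g :: "complex fps" and F A B :: real
  assumes F: "harm_conv_radius h g = ereal F" "1 \<le> F"
    and A: "alpha_H = ereal A" "0 < A" and B: "beta_H = ereal B" "0 \<le> B"
begin

definition rad :: "nat \<Rightarrow> real" where "rad n = real_of_ereal (univalence_radius n h g)"
definition c :: "nat \<Rightarrow> real" where "c n = cmod (fps_nth h n) + cmod (fps_nth g n)"
definition d :: "nat \<Rightarrow> real" where "d n = max (cmod (fps_nth h n)) (cmod (fps_nth g n))"

lemma rad: "univalence_radius n h g = ereal (rad n)" "0 \<le> rad n"
  and rad_c: "(real n + 2) * rad n * c (n + 2) \<le> 2 * (A + B) * c (n + 1)"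
  and rad_d: "(real n + 2) * rad n * d (n + 2) \<le> 2 * max A B * d (n + 1)"
proof -
  obtain r where "univalence_radius n h g = ereal r" "0 \<le> r"
    "(real n + 2) * r * c (n + 2) \<le> 2 * (A + B) * c (n + 1)"
    "(real n + 2) * r * d (n + 2) \<le> 2 * max A B * d (n + 1)"
    using univalence_radius_coeffs[OF F(1) _ A(1) B(1), of n] F(2) A(2) B(2)
    unfolding c_def d_def by auto
  moreover from this have "rad n = r" by (simp add: rad_def)
  ultimately show "univalence_radius n h g = ereal (rad n)" "0 \<le> rad n"
    "(real n + 2) * rad n * c (n + 2) \<le> 2 * (A + B) * c (n + 1)"
    "(real n + 2) * rad n * d (n + 2) \<le> 2 * max A B * d (n + 1)" by simp_all
qed

text \<open>If \<open>n * rad n > L\<close> for all large \<open>n\<close>, where \<open>L\<close>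
  exceeds the bound, then \<open>rad_c\<close> makes \<open>c\<close> decay with ratio
  \<open>2 * (A + B) / L\<close>. The radius of convergence is then at least
  \<open>L / (2 * (A + B)) > F\<close>.\<close>

lemma liminf_scaled_radius_le: 
  "liminf (\<lambda>n. ereal (real n) * univalence_radius n h g) \<le> ereal (2 * (A + B) * F)"
proof (rule ccontr)
  let ?K = "2 * (A + B)"
  assume "\<not> ?thesis"
  then have "ereal (?K * F) < liminf (\<lambda>n. ereal (real n) * univalence_radius n h g)" by (simp only: not_le)
  then obtain L where "ereal (?K * F) < ereal L" and
    lim: "ereal L < liminf (\<lambda>n. ereal (real n) * univalence_radius n h g)"
    using ereal_dense2 by blast
  then have L: "?K * F < L" by simp
  have K: "0 < ?K" using A B by simp
  then have "0 < ?K * F" using F by simp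
  then have L0: "0 < L" using L by linarith
  obtain M where M: "\<And>n. n \<ge> M \<Longrightarrow> L < real n * rad n"
    using less_LiminfD[OF lim] unfolding eventually_sequentially by (auto simp: rad(1))
  have "c (Suc (M + 1) + k) \<le> c (Suc (M + 1)) * (?K / L) ^ k" for k
  proof (rule geometric_decay_iterate)
    fix n assume "n \<ge> Suc (M + 1)"
    then have m: "n = (n - 1) + 1" "n - 1 \<ge> M" by auto
    define m where "m = n - 1"
    then have m: "n = m + 1" "m \<ge> M" using m by auto
    have "L * c (m + 2) \<le> (real m + 2) * rad m * c (m + 2)"
      using M[OF m(2)] rad(2)[of m] by (intro mult_right_mono) (auto simp: c_def distrib_right)
    then have "L * c (m + 2) \<le> ?K * c (m + 1)" using rad_c[of m] by simp
    then show "c (Suc n) \<le> ?K / L * c n" using L0 m by (simp add: field_simps)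
  qed (use K L0 in auto)
  then have "cmod (fps_nth h (Suc (M + 1) + k)) \<le> c (Suc (M + 1)) * (?K / L) ^ k"
    "cmod (fps_nth g (Suc (M + 1) + k)) \<le> c (Suc (M + 1)) * (?K / L) ^ k" for k
    unfolding c_def by (smt (verit) norm_ge_zero)+
  then have "ereal (1 / (?K / L)) \<le> harm_conv_radius h g"
    by (intro harm_conv_radius_geI divide_pos_pos K L0)
  then show False using F L K by (simp add: field_simps)
qed

text \<open>The inequalities \<open>rad_d\<close> for the indices \<open>N\<close> to
  \<open>N + m\<close> are multiplied. The factors \<open>d\<close> telescope, and the factors
  \<open>k + 2\<close> build up the quotient of the factorials.\<close>

lemma prod_radius_coeff_le:
  "(\<Prod>k=N..N+m. rad k) * fact (N + m + 2) * d (N + m + 2)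
    \<le> (2 * max A B) ^ (m + 1) * fact (N + 1) * d (N + 1)"
proof (induction m)
  case 0
  have "fact (N + 1) * ((real N + 2) * rad N * d (N + 2)) \<le> fact (N + 1) * (2 * max A B * d (N + 1))"
    by (intro mult_left_mono rad_d) auto
  then show ?case by (simp add: algebra_simps)
next
  case (Suc m)
  let ?P = "\<Prod>k=N..N+m. rad k" and ?n = "N + Suc m"
  have P: "0 \<le> ?P" by (intro prod_nonneg) (use rad in auto)
  have "(\<Prod>k=N..?n. rad k) * fact (?n + 2) * d (?n + 2)
      = ?P * fact (?n + 1) * ((real ?n + 2) * rad ?n * d (?n + 2))"
    by (simp add: algebra_simps)
  also have "\<dots> \<le> ?P * fact (?n + 1) * (2 * max A B * d (?n + 1))"
    using P by (intro mult_left_mono rad_d) auto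
  also have "\<dots> = 2 * max A B * (?P * fact (N + m + 2) * d (N + m + 2))" by simp
  also have "\<dots> \<le> 2 * max A B * ((2 * max A B) ^ (m + 1) * fact (N + 1) * d (N + 1))"
    using A by (intro mult_left_mono Suc) auto
  finally show ?case by (simp add: mult_ac)
qed

text \<open>A larger lower limit means that the product of the radii eventually exceeds
  \<open>(L / n)^n\<close>. With \<open>n^n \<le> e^n * n!\<close> this makes \<open>d\<close> decay
  with ratio \<open>q = 2 * max A B * e / L < 1 / F\<close>, so the series would converge beyond
  \<open>F\<close>.\<close>

lemma liminf_geometric_mean_le:
  "liminf (\<lambda>n. ereal (real n) * ereal_root n (\<Prod>k=N..n. univalence_radius k h g))
    \<le> ereal (2 * max A B * exp 1 * F)"
proof (rule ccontr)
  let ?K = "2 * max A B"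
  let ?P = "\<lambda>n. \<Prod>k=N..n. rad k"
  let ?X = "\<lambda>n. ereal (real n) * ereal_root n (\<Prod>k=N..n. univalence_radius k h g)"
  assume "\<not> ?thesis"
  then have "ereal (?K * exp 1 * F) < liminf ?X" by (simp only: not_le)
  then obtain L where "ereal (?K * exp 1 * F) < ereal L" and lim: "ereal L < liminf ?X"
    using ereal_dense2 by blast
  then have L: "?K * exp 1 * F < L" by simp
  have K: "0 < ?K" using A by simp
  then have "0 < ?K * exp 1 * F" using F by simp
  then have L0: "0 < L" using L by linarith
  have X: "?X n = ereal (real n * root n (?P n))" for n
    by (simp add: rad(1) prod_ereal ereal_root_def)
  obtain M0 where M0: "\<And>n. n \<ge> M0 \<Longrightarrow> L < real n * root n (?P n)"
    using less_LiminfD[OF lim] unfolding eventually_sequentially X by auto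
  define q where "q = ?K * exp 1 / L"
  have q: "0 < q" using K L0 by (simp add: q_def)
  \<comment> \<open>\<open>C\<close> collects the factors of the final estimate that do not depend
    on \<open>k\<close>.\<close>
  define C where "C = ?K ^ (M0 + 1) * exp 1 ^ (N + M0) / L ^ (N + M0) * fact (N + 1) * d (N + 1)"
  have d0: "0 \<le> d n" for n by (simp add: d_def le_max_iff_disj)
  have bound: "d (N + M0 + 2 + k) \<le> C * q ^ k" for k
  proof -
    let ?m = "M0 + k" and ?n = "N + (M0 + k)"
    \<comment> \<open>If \<open>?n\<close> were 0, then \<open>M0\<close> would be 0 and the
      sequence would exceed \<open>L > 0\<close> at index 0, where it vanishes.\<close>
    have n: "?n > 0 \<and> ?n \<ge> M0"
      using M0[of 0] L0 by (cases "?n = 0") auto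
    have P0: "0 \<le> ?P ?n" by (intro prod_nonneg) (use rad in auto)
    have "L / real ?n < root ?n (?P ?n)" using M0[of ?n] n by (simp add: pos_divide_less_eq mult.commute del: of_nat_add)
    then have "(L / real ?n) ^ ?n < root ?n (?P ?n) ^ ?n"
      using n L0 by (intro power_strict_mono) auto
    then have P: "(L / real ?n) ^ ?n \<le> ?P ?n" using n P0 by (simp add: real_root_pow_pos2)
    \<comment> \<open>Only \<open>n!\<close> is kept of \<open>(n + 2)!\<close>, to be matched with
      \<open>n^n\<close>.\<close>
    have "(L / real ?n) ^ ?n * fact ?n * d (?n + 2) \<le> ?P ?n * fact (?n + 2) * d (?n + 2)"
      using P0 P L0 by (intro mult_mono fact_mono d0) auto
    also have "\<dots> \<le> ?K ^ (?m + 1) * fact (N + 1) * d (N + 1)"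
      using prod_radius_coeff_le[of N ?m] by simp
    finally have 1: "(L / real ?n) ^ ?n * fact ?n * d (?n + 2) \<le> ?K ^ (?m + 1) * fact (N + 1) * d (N + 1)" .
    have "real ?n ^ ?n \<le> exp 1 ^ ?n * fact ?n"
      using power_self_le_exp_fact[of ?n] by (simp flip: exp_of_nat_mult)
    then have "L ^ ?n * d (?n + 2) * real ?n ^ ?n \<le> L ^ ?n * d (?n + 2) * (exp 1 ^ ?n * fact ?n)"
      using L0 d0 by (intro mult_left_mono) auto
    then have "L ^ ?n * d (?n + 2) \<le> exp 1 ^ ?n * ((L / real ?n) ^ ?n * fact ?n * d (?n + 2))"
      using n by (simp add: power_divide pos_le_divide_eq mult_ac del: of_nat_add)
    also have "\<dots> \<le> exp 1 ^ ?n * (?K ^ (?m + 1) * fact (N + 1) * d (N + 1))"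
      by (intro mult_left_mono 1) auto
    finally have "d (?n + 2) \<le> exp 1 ^ ?n * (?K ^ (?m + 1) * fact (N + 1) * d (N + 1)) / L ^ ?n"
      using L0 by (simp add: pos_le_divide_eq mult.commute)
    also have "\<dots> = C * q ^ k"
      by (simp add: C_def q_def power_add power_divide power_mult_distrib mult_ac)
    finally show ?thesis by (simp add: add_ac)
  qed
  have "ereal (1 / q) \<le> harm_conv_radius h g"
  proof (rule harm_conv_radius_geI[OF q])
    show "cmod (fps_nth h (N + M0 + 2 + k)) \<le> C * q ^ k"
      "cmod (fps_nth g (N + M0 + 2 + k)) \<le> C * q ^ k" for k
      using bound[of k] unfolding d_def by auto
  qed
  then show False using F L K L0 by (simp add: q_def field_simps)
qed

end

section \<open>Coefficient decay and the radius of convergence\<close>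

lemma ratio_power_le:
  fixes c :: "nat \<Rightarrow> real"
  assumes "0 \<le> \<rho>" "\<And>n. n \<ge> m \<Longrightarrow> c (Suc n) * \<rho> \<le> c n"
  shows "c (m + j) * \<rho> ^ j \<le> c m"
proof (induction j)
  case (Suc j)
  have "c (m + Suc j) * \<rho> ^ Suc j = (c (Suc (m + j)) * \<rho>) * \<rho> ^ j" by simp
  also have "\<dots> \<le> c (m + j) * \<rho> ^ j" using assms by (intro mult_right_mono) auto
  finally show ?case using Suc by simp
qed simp

lemma harm_conv_radius_geI':
  assumes "0 < \<rho>"
    and "\<And>j. (cmod (fps_nth h (m + j)) + cmod (fps_nth g (m + j))) * \<rho> ^ j \<le> C"
  shows "ereal \<rho> \<le> harm_conv_radius h g"
proof -
  have "ereal (1 / (1 / \<rho>)) \<le> harm_conv_radius h g"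
  proof (rule harm_conv_radius_geI)
    fix j
    have "cmod (fps_nth h (m + j)) * \<rho> ^ j \<le> C" "cmod (fps_nth g (m + j)) * \<rho> ^ j \<le> C"
      using assms(1) assms(2)[of j]
      by (smt (verit) distrib_right mult_nonneg_nonneg norm_ge_zero zero_le_power)+
    then show "cmod (fps_nth h (m + j)) \<le> C * (1 / \<rho>) ^ j" "cmod (fps_nth g (m + j)) \<le> C * (1 / \<rho>) ^ j"
      using assms(1) by (simp_all add: field_simps power_divide)
  qed (use assms in auto)
  then show ?thesis by simp
qed

lemma harm_coeffs_scaled_tendsto_0:
  assumes "0 < \<rho>" "ereal \<rho> < harm_conv_radius h g"
  shows "(\<lambda>n. (cmod (fps_nth h n) + cmod (fps_nth g n)) * \<rho> ^ n) \<longlonglongrightarrow> 0"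
proof -
  have "summable (\<lambda>n. norm (fps_nth u n * of_real \<rho> ^ n))" if "ereal \<rho> < fps_conv_radius u" for u :: "complex fps"
    using that assms by (intro norm_summable_fps) auto
  then have "(\<lambda>n. norm (fps_nth h n * of_real \<rho> ^ n) + norm (fps_nth g n * of_real \<rho> ^ n)) \<longlonglongrightarrow> 0 + 0"
    using assms by (intro tendsto_add summable_LIMSEQ_zero) (auto simp: harm_conv_radius_def)
  then show ?thesis using assms by (simp add: norm_mult norm_power distrib_right)
qed

section \<open>A univalence criterion\<close>

text \<open>A mean value estimate for \<open>p z - p_1 * z\<close>. The constant term of the series
  of \<open>p'\<close> is \<open>p_1\<close>, so \<open>B\<close> majorises the remaining terms on
  the disc.\<close>

lemma eval_fps_linear_approx:
  fixes p :: "complex fps"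
  assumes r: "0 < r" "ereal r \<le> fps_conv_radius p"
    and B: "(\<lambda>k. cmod (fps_nth (fps_deriv p) (Suc k)) * r ^ Suc k) sums B"
    and zw: "z \<in> ball 0 r" "w \<in> ball 0 r"
  shows "cmod ((eval_fps p z - eval_fps p w) - fps_nth p 1 * (z - w)) \<le> B * cmod (z - w)"
proof -
  have "cmod ((eval_fps p z - fps_nth p 1 * z) - (eval_fps p w - fps_nth p 1 * w)) \<le> B * cmod (z - w)"
  proof (rule field_differentiable_bound[where S = "ball 0 r"
        and f' = "\<lambda>u. eval_fps (fps_deriv p) u - fps_nth p 1"])
    fix u :: complex assume u: "u \<in> ball 0 r"
    then have ur: "ereal (cmod u) < fps_conv_radius p" using r(2) by (auto intro: less_le_trans[of _ "ereal r"])
    then have up: "ereal (cmod u) < fps_conv_radius (fps_deriv p)"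
      using fps_conv_radius_deriv less_le_trans by blast
    show "((\<lambda>z. eval_fps p z - fps_nth p 1 * z) has_field_derivative eval_fps (fps_deriv p) u - fps_nth p 1)
        (at u within ball 0 r)"
      by (rule DERIV_diff[OF has_field_derivative_eval_fps[OF ur]]) (auto intro!: derivative_eq_intros)
    have "(\<lambda>k. fps_nth (fps_deriv p) (Suc k) * u ^ Suc k) sums (eval_fps (fps_deriv p) u - fps_nth p 1)"
      using sums_eval_fps[OF up] by (subst sums_Suc_iff) simp
    then have e: "eval_fps (fps_deriv p) u - fps_nth p 1 = (\<Sum>k. fps_nth (fps_deriv p) (Suc k) * u ^ Suc k)"
      by (rule sums_unique)
    show "cmod (eval_fps (fps_deriv p) u - fps_nth p 1) \<le> B"
      unfolding e sums_unique[OF B]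
    proof (rule norm_suminf_le)
      show "cmod (fps_nth (fps_deriv p) (Suc k) * u ^ Suc k) \<le> cmod (fps_nth (fps_deriv p) (Suc k)) * r ^ Suc k" for k
        unfolding norm_mult norm_power using u by (intro mult_left_mono power_mono) auto
    qed (use B sums_summable in blast)
  qed (use zw in auto)
  then show ?thesis by (simp add: algebra_simps)
qed

text \<open>If \<open>z\<close> and \<open>w\<close> had the same image, the linear part of the
  difference would cancel the remainder. But the former has modulus at least
  \<open>\<bar>|p_1| - |q_1|\<bar> * |z - w|\<close>, the latter at most
  \<open>(P + Q) * |z - w|\<close>. The outer absolute value admits both orientations.\<close>

lemma harmonic_univalence_criterion:
  fixes p q :: "complex fps"
  assumes r: "0 < r" "ereal r \<le> fps_conv_radius p" "ereal r \<le> fps_conv_radius q"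
    and P: "(\<lambda>k. cmod (fps_nth (fps_deriv p) (Suc k)) * r ^ Suc k) sums P"
    and Q: "(\<lambda>k. cmod (fps_nth (fps_deriv q) (Suc k)) * r ^ Suc k) sums Q"
    and lt: "P + Q < \<bar>cmod (fps_nth p 1) - cmod (fps_nth q 1)\<bar>"
  shows "inj_on (\<lambda>z. eval_fps p z + cnj (eval_fps q z)) (ball 0 r)"
proof (rule inj_onI, rule ccontr)
  fix z w assume zw: "z \<in> ball 0 r" "w \<in> ball 0 r" "z \<noteq> w"
    and eq: "eval_fps p z + cnj (eval_fps q z) = eval_fps p w + cnj (eval_fps q w)"
  define u where "u = (eval_fps p z - eval_fps p w) - fps_nth p 1 * (z - w)"
  define v where "v = (eval_fps q z - eval_fps q w) - fps_nth q 1 * (z - w)"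
  have u: "cmod u \<le> P * cmod (z - w)"
    unfolding u_def by (rule eval_fps_linear_approx[OF r(1,2) P zw(1,2)])
  have v: "cmod v \<le> Q * cmod (z - w)"
    unfolding v_def by (rule eval_fps_linear_approx[OF r(1,3) Q zw(1,2)])
  have "fps_nth p 1 * (z - w) - (- cnj (fps_nth q 1 * (z - w))) = - (u + cnj v)"
    using eq by (simp add: u_def v_def algebra_simps)
  then have "\<bar>cmod (fps_nth p 1 * (z - w)) - cmod (- cnj (fps_nth q 1 * (z - w)))\<bar> \<le> cmod (u + cnj v)"
    by (metis norm_minus_cancel norm_triangle_ineq3)
  also have "\<dots> \<le> (P + Q) * cmod (z - w)"
    using norm_triangle_ineq[of u "cnj v"] u v by (simp add: distrib_right)
  finally have "\<bar>cmod (fps_nth p 1) * cmod (z - w) - cmod (fps_nth q 1) * cmod (z - w)\<bar> \<le> (P + Q) * cmod (z - w)"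
    by (simp only: norm_minus_cancel complex_mod_cnj norm_mult)
  then have "\<bar>cmod (fps_nth p 1) - cmod (fps_nth q 1)\<bar> * cmod (z - w) \<le> (P + Q) * cmod (z - w)"
    by (simp add: abs_mult flip: left_diff_distrib)
  then show False using lt zw(3) by simp
qed

text \<open>The binomial series with exponent \<open>-(m + 1)\<close> at \<open>- x\<close>. It
  serves as a majorant because \<open>m\<close> differentiations multiply coefficients by
  \<open>(m + k)! / k!\<close>, which is \<open>m!\<close> times the binomial coefficient.\<close>

lemma negative_binomial_sums:
  fixes x :: real
  assumes "0 \<le> x" "x < 1"
  shows "(\<lambda>k. real ((m + k) choose k) * x ^ k) sums (1 / (1 - x) ^ (m + 1))"
proof -
  have "(\<lambda>k. ((- real (m + 1)) gchoose k) * (- x) ^ k) sums (1 + - x) powr (- real (m + 1))"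
    using assms by (intro gen_binomial_real) auto
  moreover have "((- real (m + 1)) gchoose k) * (- x) ^ k = real ((m + k) choose k) * x ^ k" for k
  proof -
    have "((- real (m + 1)) gchoose k) = (-1) ^ k * real ((m + k) choose k)"
      unfolding gbinomial_minus by (simp add: binomial_gbinomial)
    then show ?thesis by (simp flip: power_mult_distrib)
  qed
  moreover have "(1 + - x) powr (- real (m + 1)) = 1 / (1 - x) ^ (m + 1)"
    using assms by (simp only: powr_minus powr_realpow) (simp add: divide_inverse powr_realpow del: of_nat_add of_nat_Suc)
  ultimately show ?thesis by simp
qed

text \<open>Let \<open>m = n + 1\<close>. By \<open>decay\<close>, the two tails in the univalence
  criterion at radius \<open>\<rho> * x\<close> add up to at most
  \<open>m! * (a m + b m) * (1 / (1 - x)^(m + 1) - 1)\<close>. By \<open>small\<close> and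
  \<open>gap\<close> this is less than \<open>m! * \<bar>a m - b m\<bar>\<close>.\<close>

lemma univalence_radius_lower_bound:
  fixes h g :: "complex fps"
  defines "a \<equiv> \<lambda>k. cmod (fps_nth h k)" and "b \<equiv> \<lambda>k. cmod (fps_nth g k)"
  assumes \<rho>: "0 < \<rho>" "ereal \<rho> \<le> harm_conv_radius h g" and x: "0 < x" "x < 1"
    and decay: "\<And>j. (a (n + 1 + j) + b (n + 1 + j)) * \<rho> ^ j \<le> a (n + 1) + b (n + 1)"
    and pos: "0 < a (n + 1) + b (n + 1)"
    and gap: "\<kappa> * (a (n + 1) + b (n + 1)) \<le> \<bar>a (n + 1) - b (n + 1)\<bar>"
    and small: "1 / (1 - x) ^ (n + 2) - 1 < \<kappa>"
  shows "ereal (\<rho> * x) \<le> univalence_radius n h g"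
proof -
  define r where "r = \<rho> * x"
  have r: "0 < r" "ereal r \<le> harm_conv_radius h g"
  proof -
    show "0 < r" using \<rho> x by (simp add: r_def)
    have "r \<le> \<rho>" using \<rho> x by (simp add: r_def mult_le_cancel_left1)
    then show "ereal r \<le> harm_conv_radius h g" using \<rho> by (meson ereal_less_eq(3) order_trans)
  qed
  define m where "m = n + 1"
  let ?p = "(fps_deriv ^^ n) h" and ?q = "(fps_deriv ^^ n) g"
  have coeff: "cmod (fps_nth (fps_deriv ((fps_deriv ^^ n) u)) k) = fact m * real ((m + k) choose k) * cmod (fps_nth u (m + k))"
    for u :: "complex fps" and k
  proof -
    have "fps_nth (fps_deriv ((fps_deriv ^^ n) u)) k = fps_nth ((fps_deriv ^^ m) u) k" by (simp add: m_def)
    also have "\<dots> = fact (m + k) / fact k * fps_nth u (m + k)" by (rule fps_nth_higher_deriv)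
    finally show ?thesis by (simp add: norm_mult norm_divide binomial_fact)
  qed
  define S where "S = (\<lambda>k. fact m * (a m + b m) * (real ((m + Suc k) choose Suc k) * x ^ Suc k))"
  have "(\<lambda>k. real ((m + Suc k) choose Suc k) * x ^ Suc k) sums (1 / (1 - x) ^ (m + 1) - 1)"
    using negative_binomial_sums[of x m] x by (subst sums_Suc_iff) simp
  then have S: "S sums (fact m * (a m + b m) * (1 / (1 - x) ^ (m + 1) - 1))"
    unfolding S_def by (rule sums_mult)
  let ?sp = "\<lambda>k. cmod (fps_nth (fps_deriv ?p) (Suc k)) * r ^ Suc k"
  let ?sq = "\<lambda>k. cmod (fps_nth (fps_deriv ?q) (Suc k)) * r ^ Suc k"
  have le: "?sp k + ?sq k \<le> S k" for k
  proof -
    have "?sp k + ?sq k = fact m * real ((m + Suc k) choose Suc k) * x ^ Suc k * ((a (m + Suc k) + b (m + Suc k)) * \<rho> ^ Suc k)"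
      unfolding coeff a_def b_def r_def power_mult_distrib by (simp only: algebra_simps)
    also have "\<dots> \<le> fact m * real ((m + Suc k) choose Suc k) * x ^ Suc k * (a m + b m)"
      using decay[of "Suc k"] x unfolding m_def by (intro mult_left_mono) auto
    finally show ?thesis unfolding S_def by (simp only: mult_ac)
  qed
  have nn: "0 \<le> ?sp k" "0 \<le> ?sq k" for k using r by auto
  have sp: "summable ?sp" and sq: "summable ?sq"
    using le nn by (auto intro!: summable_comparison_test'[OF sums_summable[OF S], of 0] simp: abs_of_nonneg)
      (smt (verit))+
  have "suminf ?sp + suminf ?sq = (\<Sum>k. ?sp k + ?sq k)" using sp sq by (rule suminf_add)
  also have "\<dots> \<le> suminf S" using le sp sq S by (intro suminf_le summable_add) (auto simp: sums_iff)
  also have "\<dots> = fact m * (a m + b m) * (1 / (1 - x) ^ (m + 1) - 1)" using S by (simp add: sums_iff)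
  also have "\<dots> < fact m * (a m + b m) * \<kappa>"
    using pos small by (intro mult_strict_left_mono) (auto simp: m_def)
  also have "\<dots> \<le> fact m * \<bar>a m - b m\<bar>" using gap by (simp add: m_def mult_ac)
  also have "\<dots> = \<bar>cmod (fps_nth ?p 1) - cmod (fps_nth ?q 1)\<bar>"
  proof -
    have 1: "cmod (fps_nth ((fps_deriv ^^ n) u) 1) = fact m * cmod (fps_nth u m)" for u :: "complex fps"
      using coeff[of u 0] by simp
    show ?thesis unfolding 1 a_def b_def by (simp add: abs_mult flip: right_diff_distrib)
  qed
  finally have "inj_on (\<lambda>z. eval_fps ?p z + cnj (eval_fps ?q z)) (ball 0 r)"
    by (rule harmonic_univalence_criterion[OF r(1) harm_conv_radius_higher_deriv[OF r(2)]
          summable_sums[OF sp] summable_sums[OF sq]])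
  moreover have "ereal (cmod z) < harm_conv_radius h g" if "z \<in> ball 0 r" for z
    using that r by (auto intro: less_le_trans[of _ "ereal r"])
  ultimately have "inj_on (harm_deriv n h g) (ball 0 r)"
    using harm_deriv_eq by (auto simp: inj_on_def)
  then show ?thesis using r univalence_radius_geI unfolding r_def by auto
qed

section \<open>Lower bounds\<close>

lemma limsup_quotient_nonneg:
  assumes "limsup_quotient b a \<delta>"
  shows "0 \<le> \<delta>"
proof -
  have "0 \<le> limsup (\<lambda>n. ereal (cmod (b n / a n)))"
    by (rule le_Limsup) auto
  then show ?thesis using assms by (simp add: limsup_quotient_def)
qed

text \<open>The map \<open>t \<mapsto> (1 - t) / (1 + t)\<close> is a decreasing involution, so
  \<open>\<delta> < (1 - \<kappa>) / (1 + \<kappa>)\<close>. The quotients eventually stay below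
  this number, and clearing denominators gives the gap.\<close>

lemma limsup_quotient_gap:
  assumes lq: "limsup_quotient b a \<delta>" and \<delta>: "\<delta> < 1" and \<kappa>: "0 < \<kappa>" "\<kappa> < (1 - \<delta>) / (1 + \<delta>)"
  shows "eventually (\<lambda>n. 0 < cmod (a n) + cmod (b n) \<and>
    \<kappa> * (cmod (a n) + cmod (b n)) \<le> \<bar>cmod (a n) - cmod (b n)\<bar>) sequentially"
proof -
  have "0 \<le> \<delta>" using limsup_quotient_nonneg lq .
  then have "\<delta> < (1 - \<kappa>) / (1 + \<kappa>)" using \<kappa> by (simp add: field_simps)
  then have "limsup (\<lambda>n. ereal (cmod (b n / a n))) < ereal ((1 - \<kappa>) / (1 + \<kappa>))"
    using lq by (simp add: limsup_quotient_def)
  then have "eventually (\<lambda>n. ereal (cmod (b n / a n)) < ereal ((1 - \<kappa>) / (1 + \<kappa>))) sequentially"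
    by (rule Limsup_lessD)
  moreover have "eventually (\<lambda>n. a n \<noteq> 0) sequentially" using lq by (simp add: limsup_quotient_def)
  ultimately show ?thesis
  proof eventually_elim
    case (elim n)
    then have "0 < cmod (a n)" by simp
    moreover from elim this have "cmod (b n) * (1 + \<kappa>) < (1 - \<kappa>) * cmod (a n)"
      using \<kappa> by (simp add: norm_divide field_simps)
    ultimately show ?case by (auto simp: algebra_simps add_pos_nonneg)
  qed
qed

text \<open>The graph of \<open>exp\<close> lies below its chord over \<open>[0, ln 2]\<close>. This
  passes from the natural bound \<open>ln (1 + \<kappa>)\<close> to the factor
  \<open>\<kappa> * ln 2\<close> of the theorem.\<close>

lemma ln_2_mult_le:
  fixes \<kappa> :: real
  assumes "0 \<le> \<kappa>" "\<kappa> \<le> 1"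
  shows "\<kappa> * ln 2 \<le> ln (1 + \<kappa>)"
proof -
  have "exp ((1 - \<kappa>) *\<^sub>R 0 + \<kappa> *\<^sub>R ln 2) \<le> (1 - \<kappa>) * exp 0 + \<kappa> * exp (ln 2 :: real)"
    using assms by (intro convex_onD[OF exp_convex]) auto
  then have "exp (\<kappa> * ln 2) \<le> 1 + \<kappa>" by simp
  then show ?thesis using assms by (simp add: ln_ge_iff)
qed

text \<open>The lower bounds are obtained under strict conditions on \<open>\<rho>\<close> and
  \<open>L\<close>. Here \<open>\<rho>\<close> approaches \<open>Rf\<close>, which may be infinite,
  and \<open>L\<close> approaches \<open>ln (1 + \<kappa>)\<close>.\<close>

lemma scaled_log_bound_leI:
  fixes X Rf :: ereal and \<kappa> :: real
  assumes \<kappa>: "0 < \<kappa>" "\<kappa> \<le> 1" and Rf: "0 < Rf"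
    and X: "\<And>\<rho> L. 0 < \<rho> \<Longrightarrow> ereal \<rho> < Rf \<Longrightarrow> 0 < L \<Longrightarrow> exp L - 1 < \<kappa> \<Longrightarrow> ereal (\<rho> * L) \<le> X"
  shows "ereal \<kappa> * Rf * ereal (ln 2) \<le> X"
proof -
  define l where "l = ln (1 + \<kappa>)"
  have l: "0 < l" "\<kappa> * ln 2 \<le> l" using \<kappa> ln_2_mult_le[of \<kappa>] by (auto simp: l_def)
  have X': "ereal (\<rho> * (t * l)) \<le> X" if "0 < \<rho>" "ereal \<rho> < Rf" "0 < t" "t < 1" for \<rho> t
  proof (rule X)
    have "exp (t * l) < exp l" using that l by simp
    then show "exp (t * l) - 1 < \<kappa>" using \<kappa> by (simp add: l_def)
  qed (use that l in auto)
  show ?thesis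
  proof (cases Rf)
    case (real F)
    then have F: "0 < F" using Rf by simp
    have "ereal (F * l) \<le> X"
    proof (cases X)
      case (real x)
      have "F * l \<le> x"
      proof (rule field_le_mult_one_interval)
        fix z :: real assume z: "0 < z" "z < 1"
        \<comment> \<open>One factor \<open>sqrt z\<close> moves \<open>\<rho>\<close> strictly
          below \<open>F\<close>, the other moves \<open>L\<close> strictly below
          \<open>l\<close>.\<close>
        then have s: "0 < sqrt z" "sqrt z < 1" "sqrt z * sqrt z = z" by auto
        have "ereal (sqrt z * F * (sqrt z * l)) \<le> X" using X'[of "sqrt z * F" "sqrt z"] s F \<open>Rf = ereal F\<close> by simp
        moreover have "sqrt z * F * (sqrt z * l) = (sqrt z * sqrt z) * (F * l)" by (simp only: mult_ac)
        ultimately show "z * (F * l) \<le> x" using s real by simp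
      qed
      then show ?thesis using real by simp
    next
      case MInf
      then show ?thesis using X'[of "F/2" "1/2"] F real by simp
    qed simp
    moreover have "ereal \<kappa> * Rf * ereal (ln 2) \<le> ereal (F * l)"
      using real F mult_left_mono[OF l(2), of F] by (simp add: mult_ac)
    ultimately show ?thesis by (rule order_trans[rotated])
  next
    case PInf
    have "X = \<infinity>"
    proof (rule ereal_top)
      fix B :: real
      \<comment> \<open>With \<open>t = 1/2\<close> this \<open>\<rho>\<close> makes the product
        equal to \<open>max B 1\<close>; the maximum keeps \<open>\<rho>\<close> positive.\<close>
      have "B \<le> (max B 1 * 2 / l) * (1/2 * l)" using l by simp
      also have "ereal \<dots> \<le> X" by (rule X') (use PInf l in auto)
      finally show "ereal B \<le> X" by simp
    qed
    then show ?thesis by simp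
  qed (use Rf in auto)
qed

text \<open>The point \<open>x = L / (m + L)\<close> is the solution of
  \<open>1 / (1 - x) = 1 + L / m\<close>.\<close>

lemma inverse_one_minus_power_le_exp:
  fixes L :: real
  assumes "0 < L" "0 < m"
  shows "1 / (1 - L / (real m + L)) ^ m \<le> exp L"
proof -
  have "1 / (1 - L / (real m + L)) = 1 + L / real m" using assms by (simp add: field_simps)
  then have "1 / (1 - L / (real m + L)) ^ m = (1 + L / real m) ^ m" by (metis power_one_over)
  also have "\<dots> \<le> exp (L / real m) ^ m"
    using assms exp_ge_add_one_self by (intro power_mono) auto
  also have "\<dots> = exp L" using assms by (simp flip: exp_of_nat_mult)
  finally show ?thesis .
qed

text \<open>The decay remains a premise for each \<open>n\<close>, because it is supplied for
  infinitely many \<open>n\<close> in one application and for all large \<open>n\<close> in the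
  other.\<close>

lemma univalence_radius_eventually_ge:
  fixes h g :: "complex fps"
  defines "c \<equiv> \<lambda>k. cmod (fps_nth h k) + cmod (fps_nth g k)"
  assumes lq: "limsup_quotient (fps_nth g) (fps_nth h) \<delta> \<or> limsup_quotient (fps_nth h) (fps_nth g) \<delta>"
    and \<delta>: "\<delta> < 1" and \<rho>: "0 < \<rho>" "ereal \<rho> < harm_conv_radius h g"
    and L: "0 < L" "exp L - 1 < (1 - \<delta>) / (1 + \<delta>)"
  shows "eventually (\<lambda>n. 0 < c (n + 1) \<and> ((\<forall>j. c (n + 1 + j) * \<rho> ^ j \<le> c (n + 1)) \<longrightarrow>
    ereal (\<rho> * (L / (real n + 2 + L))) \<le> univalence_radius n h g)) sequentially"
proof -
  \<comment> \<open>Room on both sides of \<open>\<kappa>\<close>: the lower inequality serves the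
    smallness condition, the upper one the upper limit of the quotients.\<close>
  obtain \<kappa> where \<kappa>: "exp L - 1 < \<kappa>" "\<kappa> < (1 - \<delta>) / (1 + \<delta>)" using dense L(2) by blast
  have "0 < exp L - 1" using L by simp
  then have \<kappa>0: "0 < \<kappa>" using \<kappa> by linarith
  have "eventually (\<lambda>n. 0 < c n \<and> \<kappa> * c n \<le> \<bar>cmod (fps_nth h n) - cmod (fps_nth g n)\<bar>) sequentially"
    using lq
  proof
    assume "limsup_quotient (fps_nth g) (fps_nth h) \<delta>"
    from limsup_quotient_gap[OF this \<delta> \<kappa>0 \<kappa>(2)] show ?thesis by (simp add: c_def)
  next
    assume "limsup_quotient (fps_nth h) (fps_nth g) \<delta>"
    from limsup_quotient_gap[OF this \<delta> \<kappa>0 \<kappa>(2)] show ?thesis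
      by (simp add: c_def add.commute abs_minus_commute)
  qed
  then have "eventually (\<lambda>n. 0 < c (n + 1) \<and> \<kappa> * c (n + 1) \<le> \<bar>cmod (fps_nth h (n + 1)) - cmod (fps_nth g (n + 1))\<bar>) sequentially"
    by (rule eventually_compose_filterlim[OF _ filterlim_add_const_nat_at_top])
  then show ?thesis
  proof eventually_elim
    case (elim n)
    have "1 / (1 - L / (real n + 2 + L)) ^ (n + 2) - 1 < \<kappa>"
      using inverse_one_minus_power_le_exp[OF L(1), of "n + 2"] \<kappa>(1) by (simp add: add_ac)
    then show ?case
      using univalence_radius_lower_bound[OF \<rho>(1) less_imp_le[OF \<rho>(2)], of "L / (real n + 2 + L)" n \<kappa>] elim L
      by (auto simp: c_def)
  qed
qed

lemma scaled_bound_tendsto: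
  fixes \<rho> L :: real
  assumes "0 < L"
  shows "(\<lambda>n. real n * (\<rho> * (L / (real n + 2 + L)))) \<longlonglongrightarrow> \<rho> * L"
proof -
  have "filterlim (\<lambda>n. (2 + L) + real n) at_top sequentially"
    by (intro filterlim_tendsto_add_at_top[OF tendsto_const] filterlim_real_sequentially)
  then have "(\<lambda>n. \<rho> * L - \<rho> * L * (2 + L) * inverse ((2 + L) + real n)) \<longlonglongrightarrow> \<rho> * L - \<rho> * L * (2 + L) * 0"
    by (intro tendsto_intros tendsto_inverse_0_at_top)
  moreover have "\<rho> * L - \<rho> * L * (2 + L) * inverse ((2 + L) + real n) = real n * (\<rho> * (L / (real n + 2 + L)))" for n
    using assms by (simp add: divide_simps) (simp add: algebra_simps)
  ultimately show ?thesis by simp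
qed

text \<open>The sequence \<open>c n * \<rho> ^ n\<close> tends to 0 and is positive at
  \<open>M\<close>, so it has a largest term, at some \<open>m\<close>, among those with
  \<open>n \<ge> M\<close>. Comparing the term at \<open>m + j\<close> with it and cancelling
  \<open>\<rho> ^ m\<close> gives the decay.\<close>

lemma frequently_scaled_decay:
  fixes c :: "nat \<Rightarrow> real"
  assumes lim: "(\<lambda>n. c n * \<rho> ^ n) \<longlonglongrightarrow> 0" and \<rho>: "0 < \<rho>"
    and pos: "eventually (\<lambda>n. 0 < c (n + 1)) sequentially"
  shows "frequently (\<lambda>n. \<forall>j. c (n + 1 + j) * \<rho> ^ j \<le> c (n + 1)) sequentially"
  unfolding frequently_sequentially
proof
  fix M0
  obtain M1 where M1: "\<And>n. n \<ge> M1 \<Longrightarrow> 0 < c (n + 1)" using pos by (auto simp: eventually_sequentially)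
  \<comment> \<open>The shift by 1 ensures \<open>m - 1 \<ge> M0\<close> for the order
    \<open>m - 1\<close> of the derivative; \<open>M1\<close> makes the term at \<open>M\<close>
    positive.\<close>
  define M where "M = max M0 M1 + 1"
  define u where "u = (\<lambda>n. c n * \<rho> ^ n)"
  have uM: "0 < u M" using M1[of "max M0 M1"] \<rho> by (simp add: u_def M_def)
  obtain K where K: "\<And>n. n \<ge> K \<Longrightarrow> u n < u M"
    using order_tendstoD(2)[OF lim, of "u M"] uM by (auto simp: u_def eventually_sequentially)
  have "Max (u ` {M..max K M}) \<in> u ` {M..max K M}" by (intro Max_in) auto
  then obtain m where m: "m \<in> {M..max K M}" and "u m = Max (u ` {M..max K M})"
    by (metis imageE)
  then have mmax: "u n \<le> u m" if "n \<in> {M..max K M}" for n using that by simp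
  have all: "u n \<le> u m" if "n \<ge> M" for n
  proof (cases "n \<le> max K M")
    case False
    then have "u n < u M" using K by simp
    also have "u M \<le> u m" using mmax by simp
    finally show ?thesis by simp
  qed (use mmax that in auto)
  have m': "m = (m - 1) + 1" "m - 1 \<ge> M0" using m by (auto simp: M_def)
  have "c (m + j) * \<rho> ^ j \<le> c m" for j
  proof -
    have "\<rho> ^ m * (c (m + j) * \<rho> ^ j) \<le> \<rho> ^ m * c m"
      using all[of "m + j"] m by (simp add: u_def power_add mult_ac)
    then show ?thesis using \<rho> by simp
  qed
  then have "\<forall>j. c ((m - 1) + 1 + j) * \<rho> ^ j \<le> c ((m - 1) + 1)" using m' by simp
  then show "\<exists>n\<ge>M0. \<forall>j. c (n + 1 + j) * \<rho> ^ j \<le> c (n + 1)" using m'(2) by blast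
qed

lemma le_limsupI_frequently:
  fixes X :: "nat \<Rightarrow> ereal"
  assumes lim: "(f \<longlonglongrightarrow> l)" and fr: "frequently (\<lambda>n. ereal (f n) \<le> X n) sequentially"
  shows "ereal l \<le> limsup X"
proof (rule ccontr)
  assume "\<not> ?thesis"
  then obtain y where y: "limsup X < ereal y" "ereal y < ereal l" using ereal_dense2 by (metis not_le)
  have "eventually (\<lambda>n. y < f n) sequentially" using order_tendstoD(1)[OF lim] y by simp
  moreover have "eventually (\<lambda>n. X n < ereal y) sequentially" using Limsup_lessD[OF y(1)] .
  ultimately have "eventually (\<lambda>n. \<not> ereal (f n) \<le> X n) sequentially"
    by eventually_elim (meson ereal_less_eq(3) less_le_trans not_le less_ereal.simps(1) less_trans)
  then show False using fr by (simp add: frequently_def)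
qed

lemma le_liminfI_eventually:
  fixes X :: "nat \<Rightarrow> ereal"
  assumes lim: "(f \<longlonglongrightarrow> l)" and ev: "eventually (\<lambda>n. ereal (f n) \<le> X n) sequentially"
  shows "ereal l \<le> liminf X"
proof -
  have "liminf (\<lambda>n. ereal (f n)) = ereal l" using lim by (intro lim_imp_Liminf) auto
  then show ?thesis using Liminf_mono[OF ev] by simp
qed

section \<open>Monotone coefficient ratios\<close>

locale monotone_coeff_ratio =
  fixes h g :: "complex fps" and N :: nat
  assumes N: "0 < N"
    and ratio: "\<And>n. n \<ge> N \<Longrightarrow> cmod (fps_nth h n) + cmod (fps_nth g n) \<noteq> 0 \<and>
      0 < coeff_ratio (fps_nth h) (fps_nth g) (n - 1) \<and>
      coeff_ratio (fps_nth h) (fps_nth g) (n - 1) \<le> coeff_ratio (fps_nth h) (fps_nth g) n"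
begin

definition c :: "nat \<Rightarrow> real" where "c n = cmod (fps_nth h n) + cmod (fps_nth g n)"
abbreviation q :: "nat \<Rightarrow> real" where "q \<equiv> coeff_ratio (fps_nth h) (fps_nth g)"

lemma q: "q n = c n / c (Suc n)"
  by (simp add: coeff_ratio_def c_def)

lemma c_pos: "n \<ge> N \<Longrightarrow> 0 < c n"
  using ratio[of n] unfolding c_def by (smt (verit) norm_ge_zero)

lemma q_pos: "n \<ge> N \<Longrightarrow> 0 < q n"
  using ratio[of "Suc n"] by simp

lemma q_mono:
  assumes "N \<le> m" "m \<le> n"
  shows "q m \<le> q n"
  using assms(2)
proof (induction n rule: dec_induct)
  case (step n)
  then show ?case using ratio[of "Suc n"] assms(1) by simp
qed simp

lemma scaled_decay:
  assumes "m \<ge> N" "0 \<le> \<rho>" "\<rho> \<le> q m"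
  shows "c (m + j) * \<rho> ^ j \<le> c m"
proof (rule ratio_power_le)
  fix n assume n: "m \<le> n"
  then have "\<rho> \<le> c n / c (Suc n)" using assms q_mono[of m n] by (simp add: q)
  then show "c (Suc n) * \<rho> \<le> c n"
    using c_pos[of "Suc n"] n assms by (simp add: pos_le_divide_eq mult.commute)
qed (use assms in auto)

text \<open>From \<open>m\<close> on all ratios are at least \<open>q m\<close>, so \<open>c\<close>
  is dominated by a geometric sequence with ratio \<open>1 / q m\<close>.\<close>

lemma ratio_le_harm_conv_radius:
  assumes "m \<ge> N"
  shows "ereal (q m) \<le> harm_conv_radius h g"
  using scaled_decay[of m "q m"] q_pos[of m] assms unfolding c_def
  by (intro harm_conv_radius_geI'[where m = m]) auto

text \<open>Otherwise monotonicity gives \<open>q n < \<rho>\<close> for all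
  \<open>n \<ge> N\<close>. Then \<open>c n * \<rho> ^ n\<close> is nondecreasing from a positive
  value on, although it tends to 0.\<close>

lemma eventually_ratio_ge:
  assumes \<rho>: "0 < \<rho>" "ereal \<rho> < harm_conv_radius h g"
  shows "eventually (\<lambda>n. \<rho> \<le> q n) sequentially"
proof (rule ccontr)
  assume not: "\<not> ?thesis"
  have small: "q n < \<rho>" if n: "n \<ge> N" for n
  proof (rule ccontr)
    assume "\<not> q n < \<rho>"
    then have "\<forall>k\<ge>n. \<rho> \<le> q k" using q_mono n by (metis not_less order_trans)
    then show False using not by (auto simp: eventually_sequentially)
  qed
  define u where "u = (\<lambda>n. c n * \<rho> ^ n)"
  have "u N \<le> u n" if "n \<ge> N" for n
    using that
  proof (induction n rule: dec_induct)
    case (step n)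
    have "c n \<le> \<rho> * c (Suc n)"
      using small[of n] step c_pos[of "Suc n"] by (simp add: q pos_divide_less_eq)
    then have "c n * \<rho> ^ n \<le> (\<rho> * c (Suc n)) * \<rho> ^ n" using \<rho> by (intro mult_right_mono) auto
    then show ?case using step by (simp add: u_def mult_ac)
  qed simp
  moreover have "0 < u N" using c_pos[of N] \<rho> by (simp add: u_def)
  moreover have "u \<longlonglongrightarrow> 0"
    using harm_coeffs_scaled_tendsto_0[OF \<rho>] by (simp add: u_def c_def)
  ultimately show False
    using LIMSEQ_le_const[of u 0 "u N"] by force
qed

end

text \<open>Every single ratio \<open>q (n + 1)\<close> is at most \<open>F\<close>, so
  \<open>rad_c\<close> bounds \<open>n * rad n\<close> for each \<open>n \<ge> N\<close>.\<close>

lemma limsup_scaled_radius_le: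
  assumes "finite_harmonic h g F A B" and "monotone_coeff_ratio h g N"
  shows "limsup (\<lambda>n. ereal (real n) * univalence_radius n h g) \<le> ereal (2 * (A + B) * F)"
proof (rule Limsup_bounded)
  interpret finite_harmonic h g F A B by fact
  interpret M: monotone_coeff_ratio h g N by fact
  have cM: "M.c = c" by (simp add: fun_eq_iff M.c_def c_def)
  show "eventually (\<lambda>n. ereal (real n) * univalence_radius n h g \<le> ereal (2 * (A + B) * F)) sequentially"
    using eventually_ge_at_top[of N]
  proof eventually_elim
    case (elim n)
    have c: "0 < c (n + 2)" using M.c_pos[of "n + 2"] elim cM by simp
    have "M.q (n + 1) \<le> F" using M.ratio_le_harm_conv_radius[of "n + 1"] elim F by simp
    then have "c (n + 1) \<le> F * c (n + 2)" using c by (simp add: M.q cM pos_divide_le_eq)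
    then have "2 * (A + B) * c (n + 1) \<le> 2 * (A + B) * (F * c (n + 2))"
      using A B by (intro mult_left_mono) auto
    then have "(real n + 2) * rad n * c (n + 2) \<le> 2 * (A + B) * F * c (n + 2)"
      using rad_c[of n] by (simp add: mult_ac)
    then have "(real n + 2) * rad n \<le> 2 * (A + B) * F" using c by simp
    moreover have "real n * rad n \<le> (real n + 2) * rad n" using rad(2) by (intro mult_right_mono) auto
    ultimately show ?case by (simp add: rad(1))
  qed
qed

lemma limsup_quotient_factor:
  assumes "limsup_quotient b a \<delta> \<or> limsup_quotient a b \<delta>" "\<delta> < 1"
  shows "0 < (1 - \<delta>) / (1 + \<delta>)" "(1 - \<delta>) / (1 + \<delta>) \<le> 1"
proof -
  have "0 \<le> \<delta>" using assms(1) limsup_quotient_nonneg by blast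
  then show "0 < (1 - \<delta>) / (1 + \<delta>)" "(1 - \<delta>) / (1 + \<delta>) \<le> 1" using assms(2) by auto
qed

lemma limsup_scaled_radius_ge:
  assumes R: "0 < harm_conv_radius h g" and \<delta>: "\<delta> < 1"
    and lq: "limsup_quotient (fps_nth g) (fps_nth h) \<delta> \<or> limsup_quotient (fps_nth h) (fps_nth g) \<delta>"
  shows "ereal ((1 - \<delta>) / (1 + \<delta>)) * harm_conv_radius h g * ereal (ln 2)
    \<le> limsup (\<lambda>n. ereal (real n) * univalence_radius n h g)"
proof (rule scaled_log_bound_leI[OF limsup_quotient_factor[OF lq \<delta>] R])
  fix \<rho> L :: real assume \<rho>: "0 < \<rho>" "ereal \<rho> < harm_conv_radius h g"
    and L: "0 < L" "exp L - 1 < (1 - \<delta>) / (1 + \<delta>)"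
  note ev = univalence_radius_eventually_ge[OF lq \<delta> \<rho> L]
  show "ereal (\<rho> * L) \<le> limsup (\<lambda>n. ereal (real n) * univalence_radius n h g)"
  proof (rule le_limsupI_frequently[OF scaled_bound_tendsto[OF L(1)]])
    from ev have "eventually (\<lambda>n. 0 < cmod (fps_nth h (n + 1)) + cmod (fps_nth g (n + 1))) sequentially"
      by eventually_elim blast
    \<comment> \<open>Decay for infinitely many \<open>n\<close> suffices for an upper limit, since
      the implication in \<open>ev\<close> holds for all large \<open>n\<close>.\<close>
    then have "frequently (\<lambda>n. \<forall>j. (cmod (fps_nth h (n + 1 + j)) + cmod (fps_nth g (n + 1 + j))) * \<rho> ^ j
        \<le> cmod (fps_nth h (n + 1)) + cmod (fps_nth g (n + 1))) sequentially"
      by (rule frequently_scaled_decay[OF harm_coeffs_scaled_tendsto_0[OF \<rho>] \<rho>(1)])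
    then show "frequently (\<lambda>n. ereal (real n * (\<rho> * (L / (real n + 2 + L))))
        \<le> ereal (real n) * univalence_radius n h g) sequentially"
    proof (rule frequently_rev_mp)
      show "eventually (\<lambda>n. (\<forall>j. (cmod (fps_nth h (n + 1 + j)) + cmod (fps_nth g (n + 1 + j))) * \<rho> ^ j
        \<le> cmod (fps_nth h (n + 1)) + cmod (fps_nth g (n + 1))) \<longrightarrow>
          ereal (real n * (\<rho> * (L / (real n + 2 + L)))) \<le> ereal (real n) * univalence_radius n h g) sequentially"
        using ev
      proof eventually_elim
        case (elim n)
        then show ?case
          unfolding times_ereal.simps(1)[symmetric] by (intro impI ereal_mult_left_mono) auto
      qed
    qed
  qed
qed

lemma liminf_scaled_radius_ge:
  assumes R: "0 < harm_conv_radius h g" and \<delta>: "\<delta> < 1"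
    and lq: "limsup_quotient (fps_nth g) (fps_nth h) \<delta> \<or> limsup_quotient (fps_nth h) (fps_nth g) \<delta>"
    and "monotone_coeff_ratio h g N"
  shows "ereal ((1 - \<delta>) / (1 + \<delta>)) * harm_conv_radius h g * ereal (ln 2)
    \<le> liminf (\<lambda>n. ereal (real n) * univalence_radius n h g)"
proof (rule scaled_log_bound_leI[OF limsup_quotient_factor[OF lq \<delta>] R])
  interpret monotone_coeff_ratio h g N by fact
  fix \<rho> L :: real assume \<rho>: "0 < \<rho>" "ereal \<rho> < harm_conv_radius h g"
    and L: "0 < L" "exp L - 1 < (1 - \<delta>) / (1 + \<delta>)"
  show "ereal (\<rho> * L) \<le> liminf (\<lambda>n. ereal (real n) * univalence_radius n h g)"
  proof (rule le_liminfI_eventually[OF scaled_bound_tendsto[OF L(1)]])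
    \<comment> \<open>Monotone ratios provide the decay for all large \<open>n\<close>, which a
      lower limit requires.\<close>
    have "eventually (\<lambda>n. \<rho> \<le> q (n + 1)) sequentially"
      using eventually_ratio_ge[OF \<rho>]
      by (rule eventually_compose_filterlim[OF _ filterlim_add_const_nat_at_top])
    then show "eventually (\<lambda>n. ereal (real n * (\<rho> * (L / (real n + 2 + L))))
        \<le> ereal (real n) * univalence_radius n h g) sequentially"
      using univalence_radius_eventually_ge[OF lq \<delta> \<rho> L] eventually_ge_at_top[of N]
    proof eventually_elim
      case (elim n)
      then have "ereal (\<rho> * (L / (real n + 2 + L))) \<le> univalence_radius n h g"
        using scaled_decay[of "n + 1" \<rho>] \<rho> by (simp add: c_def)
      then show ?case
        unfolding times_ereal.simps(1)[symmetric] by (intro ereal_mult_left_mono) auto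
    qed
  qed
qed

section \<open>Combination of the four statements\<close>

theorem theorem5:
  fixes h g :: "complex fps" and a b :: "nat \<Rightarrow> complex" and R :: "nat \<Rightarrow> ereal" and Rf :: ereal
  assumes f_in_S_H: "(h, g) \<in> S_H"
    and a_def: "a = fps_nth h" and b_def: "b = fps_nth g"
    and Rf_def: "Rf = harm_conv_radius h g"
    and R_def: "R = (\<lambda>n. univalence_radius n h g)"
  shows
    "liminf (\<lambda>n. ereal (real n) * R n) \<le> 2 * (alpha_H + beta_H) * Rf
     \<and>
     (\<forall>\<delta>::real. \<delta> < 1 \<longrightarrow> limsup_quotient b a \<delta> \<or> limsup_quotient a b \<delta> \<longrightarrow>
        ereal ((1 - \<delta>) / (1 + \<delta>)) * Rf * ereal (ln 2) \<le> limsup (\<lambda>n. ereal (real n) * R n))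
     \<and>
     (\<forall>N::nat. (\<forall>n\<ge>N. R n > 0) \<longrightarrow>
        liminf (\<lambda>n. ereal (real n) * ereal_root n (\<Prod>k=N..n. R k))
          \<le> 2 * max alpha_H beta_H * ereal (exp 1) * Rf)
     \<and>
     (\<forall>(\<delta>::real) (N::nat).
        \<delta> < 1 \<longrightarrow> limsup_quotient b a \<delta> \<or> limsup_quotient a b \<delta> \<longrightarrow>
        N > 0 \<longrightarrow>
        (\<forall>n\<ge>N. cmod (a n) + cmod (b n) \<noteq> 0 \<and> coeff_ratio a b (n - 1) > 0 \<and>
                coeff_ratio a b (n - 1) \<le> coeff_ratio a b n) \<longrightarrow>
        ereal ((1 - \<delta>) / (1 + \<delta>)) * Rf * ereal (ln 2) \<le> liminf (\<lambda>n. ereal (real n) * R n) \<and>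
        liminf (\<lambda>n. ereal (real n) * R n) \<le> limsup (\<lambda>n. ereal (real n) * R n) \<and>
        limsup (\<lambda>n. ereal (real n) * R n) \<le> 2 * (alpha_H + beta_H) * Rf)"
proof -
  have Rf1: "1 \<le> Rf" using S_H_harm_conv_radius[OF f_in_S_H] by (simp add: Rf_def)
  then have Rf0: "0 < harm_conv_radius h g"
    unfolding Rf_def by (rule less_le_trans[rotated]) simp
  note \<alpha>0 = alpha_H_pos and \<beta>0 = beta_H_nonneg[OF f_in_S_H]
  \<comment> \<open>If \<open>alpha_H\<close>, \<open>beta_H\<close> or \<open>Rf\<close> is
    infinite, the positivity of the other factors makes both bounds infinite and the upper estimates
    trivial.\<close>
  consider (infinite) "2 * (alpha_H + beta_H) * Rf = \<infinity>" "2 * max alpha_H beta_H * ereal (exp 1) * Rf = \<infinity>"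
    | (finite) F A B where "finite_harmonic h g F A B"
        "2 * (alpha_H + beta_H) * Rf = ereal (2 * (A + B) * F)"
        "2 * max alpha_H beta_H * ereal (exp 1) * Rf = ereal (2 * max A B * exp 1 * F)"
  proof (cases "alpha_H = \<infinity> \<or> beta_H = \<infinity> \<or> Rf = \<infinity>")
    case True
    have m: "0 < alpha_H + beta_H" "0 < max alpha_H beta_H" "0 < Rf"
      using \<alpha>0 \<beta>0 Rf0 by (auto simp: Rf_def add_pos_nonneg less_max_iff_disj)
    show ?thesis
      by (rule infinite) (use True m in \<open>auto simp: ereal_mult_eq_PInfty max_def ereal_zero_less_0_iff\<close>)
  next
    case False
    then obtain F A B where eq: "Rf = ereal F" "alpha_H = ereal A" "beta_H = ereal B"
      using \<alpha>0 \<beta>0 Rf1 by (cases Rf; cases alpha_H; cases beta_H) auto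
    have "1 \<le> F" using Rf1 unfolding eq by (simp add: one_ereal_def)
    moreover have "0 < A" using \<alpha>0 unfolding eq by simp
    moreover have "0 \<le> B" using \<beta>0 unfolding eq by simp
    ultimately have fh: "finite_harmonic h g F A B"
      using eq by unfold_locales (simp_all add: Rf_def)
    show ?thesis
    proof (rule finite)
      show "finite_harmonic h g F A B" by (rule fh)
    qed (unfold eq, simp_all add: max_def)
  qed
  note cases = this
  have "liminf (\<lambda>n. ereal (real n) * R n) \<le> 2 * (alpha_H + beta_H) * Rf"
  proof (cases rule: cases)
    case infinite
    show ?thesis unfolding infinite by simp
  next
    case (finite F A B)
    show ?thesis unfolding finite R_def by (rule finite_harmonic.liminf_scaled_radius_le[OF finite(1)])
  qed
  moreover have "liminf (\<lambda>n. ereal (real n) * ereal_root n (\<Prod>k=N..n. R k))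
      \<le> 2 * max alpha_H beta_H * ereal (exp 1) * Rf" for N
  proof (cases rule: cases)
    case infinite
    show ?thesis unfolding infinite by simp
  next
    case (finite F A B)
    show ?thesis unfolding finite R_def by (rule finite_harmonic.liminf_geometric_mean_le[OF finite(1)])
  qed
  moreover have "limsup (\<lambda>n. ereal (real n) * R n) \<le> 2 * (alpha_H + beta_H) * Rf"
    if "monotone_coeff_ratio h g N" for N
  proof (cases rule: cases)
    case infinite
    show ?thesis unfolding infinite by simp
  next
    case (finite F A B)
    show ?thesis unfolding finite R_def by (rule limsup_scaled_radius_le[OF finite(1) that])
  qed
  moreover have "monotone_coeff_ratio h g N"
    if "N > 0" "\<forall>n\<ge>N. cmod (a n) + cmod (b n) \<noteq> 0 \<and> coeff_ratio a b (n - 1) > 0 \<and>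
                coeff_ratio a b (n - 1) \<le> coeff_ratio a b n" for N
    using that by unfold_locales (auto simp: a_def b_def)
  moreover have "liminf (\<lambda>n. ereal (real n) * R n) \<le> limsup (\<lambda>n. ereal (real n) * R n)"
    by (rule Liminf_le_Limsup) simp
  ultimately show ?thesis
    using limsup_scaled_radius_ge[OF Rf0] liminf_scaled_radius_ge[OF Rf0]
    unfolding a_def b_def Rf_def R_def by blast
qed

end
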